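(* For every integer $N\geq 2$, $$\varepsilon_0(N,3)=2\sum_{i=0}^{N-2}\Bigl(\varepsilon_0(i)\,\varepsilon_0(N-i-1,3)+\varepsilon_0(i,2)\,\varepsilon_0(N-i-1,2)\Bigr)+\sum_{i=1}^{2N-3}(i+1)(i+2)\,\tilde{\varepsilon}_0(2N-2,i,2).$$
   Context: Let $N\ge 1$, $K\ge 1$. A gluing datum with $N$ edges and $K$ faces consists of a composition $(m_1,\dots,m_K)$ of $2N$ into positive integers and a fixed-point-free involution $\iota$ of $\{1,\dots,2N\}$. With $s_0=0$, $s_i=m_1+\dots+m_i$, let $\tau$ be the permutation with cycles $(s_{i-1}+1,\dots,s_i)$, $i=1,\dots,K$. The datum is connected if $\langle\iota,\tau\rangle$ acts transitively, and has genus $g$ if $\tau\iota$ has exactly $N-K+2-2g$ cycles. (Geometrically: gluing $K$ numbered polygons with distinguished edges, having $2N$ edges in total, into a connected closed orientable surface of genus $g$ by gluing paired edges with opposite orientations.) $\varepsilon_g(N,K)$ is the number of connected genus-$g$ data; $\varepsilon_0(0,1)=1$, $\varepsilon_g(0,K)=0$ if $g+K>1$; $\varepsilon_g(N):=\varepsilon_g(N,1)$. For integers $n,M,K$, $\tilde{\varepsilon}_0(n,M,K)$ is the number of connected genus-$0$ gluing data with $n/2$ edges (i.e. compositions of $n$) and $K$ faces such that $m_1=M$; it is $0$ if $n$ is odd or if the required composition does not exist. *)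

theory Defs
  imports
    "HOL-Algebra.Sym_Groups"
    "HOL-Algebra.Generated_Groups"
    "HOL-Combinatorics.Orbits"
begin

definition composition :: "nat list \<Rightarrow> nat \<Rightarrow> bool" where
  "composition ms n \<longleftrightarrow> (\<forall>m\<in>set ms. m > 0) \<and> sum_list ms = n"

text \<open>Permutations of \<open>{1..n}\<close> are represented, as in the library, by functions on all naturals
  that fix every point outside \<open>{1..n}\<close>, so distinct functions are distinct permutations.\<close>

definition fpf_involution :: "(nat \<Rightarrow> nat) \<Rightarrow> nat \<Rightarrow> bool" where
  "fpf_involution \<iota> n \<longleftrightarrow> \<iota> permutes {1..n} \<and> (\<forall>x\<in>{1..n}. \<iota> (\<iota> x) = x \<and> \<iota> x \<noteq> x)"

definition psum :: "nat list \<Rightarrow> nat \<Rightarrow> nat" where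
  "psum ms i = sum_list (take i ms)"

text \<open>The product of the disjoint cycles \<open>(s\<^bsub>i-1\<^esub> + 1, \<dots>, s\<^sub>i)\<close>; the index below is shifted by one.\<close>

definition face_perm :: "nat list \<Rightarrow> nat \<Rightarrow> nat" where
  "face_perm ms =
     foldr (\<circ>) (map (\<lambda>i. cycle_of_list [psum ms i + 1 ..< psum ms (i + 1) + 1]) [0..<length ms]) id"

definition gluing_datum :: "nat \<Rightarrow> nat \<Rightarrow> nat list \<times> (nat \<Rightarrow> nat) \<Rightarrow> bool" where
  "gluing_datum N K = (\<lambda>(ms, \<iota>). N \<ge> 1 \<and> K \<ge> 1 \<and>
     composition ms (2 * N) \<and> length ms = K \<and> fpf_involution \<iota> (2 * N))"

definition connected_datum :: "nat \<Rightarrow> nat list \<times> (nat \<Rightarrow> nat) \<Rightarrow> bool" where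
  "connected_datum N = (\<lambda>(ms, \<iota>). \<forall>x\<in>{1..2 * N}. \<forall>y\<in>{1..2 * N}.
     \<exists>p\<in>generate (sym_group (2 * N)) {\<iota>, face_perm ms}. p x = y)"

text \<open>Fixed points count as cycles of length one.\<close>

definition num_cycles :: "nat \<Rightarrow> (nat \<Rightarrow> nat) \<Rightarrow> nat" where
  "num_cycles n p = card (orbit p ` {1..n})"

definition has_genus :: "nat \<Rightarrow> nat \<Rightarrow> nat \<Rightarrow> nat list \<times> (nat \<Rightarrow> nat) \<Rightarrow> bool" where
  "has_genus g N K = (\<lambda>(ms, \<iota>).
     int (num_cycles (2 * N) (face_perm ms \<circ> \<iota>)) = int N - int K + 2 - 2 * int g)"

definition connected_data :: "nat \<Rightarrow> nat \<Rightarrow> nat \<Rightarrow> (nat list \<times> (nat \<Rightarrow> nat)) set" where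
  "connected_data g N K = {d. gluing_datum N K d \<and> connected_datum N d \<and> has_genus g N K d}"

definition eps :: "nat \<Rightarrow> nat \<Rightarrow> nat \<Rightarrow> nat" where
  "eps g N K = (if N = 0 then (if g = 0 \<and> K = 1 then 1 else 0) else card (connected_data g N K))"

abbreviation eps1 :: "nat \<Rightarrow> nat \<Rightarrow> nat" where
  "eps1 g N \<equiv> eps g N 1"

text \<open>For even \<open>n \<le> 0\<close>, for \<open>K \<le> 0\<close> and for \<open>M \<le> 0\<close> the set counted below is empty.\<close>

definition eps_tilde0 :: "int \<Rightarrow> int \<Rightarrow> int \<Rightarrow> nat" where
  "eps_tilde0 n M K = (if odd n then 0
     else card {(ms, \<iota>). (ms, \<iota>) \<in> connected_data 0 (nat (n div 2)) (nat K) \<and> int (hd ms) = M})"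

lemma finite_connected_data: "finite (connected_data g N K)"
proof (rule finite_subset)
  show "connected_data g N K \<subseteq>
      {ms. set ms \<subseteq> {..2 * N} \<and> length ms = K} \<times> {\<iota>. \<iota> permutes {1..2 * N}}"
    by (auto simp: connected_data_def gluing_datum_def composition_def fpf_involution_def
        dest: member_le_sum_list)
  show "finite ({ms. set ms \<subseteq> {..2 * N} \<and> length ms = K} \<times> {\<iota>. \<iota> permutes {1..2 * N}})"
    by (intro finite_cartesian_product finite_lists_length_eq finite_permutations) auto
qed

lemma face_perm_permutes:
  assumes "composition ms n"
  shows "face_perm ms permutes {1..n}"
proof -
  have *: "foldr (\<circ>) fs id permutes A" if "\<forall>f\<in>set fs. f permutes A"
    for fs :: "(nat \<Rightarrow> nat) list" and A
    using that by (induction fs) (auto intro: permutes_compose simp: permutes_id)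
  have le: "psum ms i \<le> n" for i
    using assms sum_list_append[of "take i ms" "drop i ms"]
    by (simp add: psum_def composition_def)
  show ?thesis
    unfolding face_perm_def
  proof (rule *, rule ballI)
    fix f
    assume "f \<in> set (map (\<lambda>i. cycle_of_list [psum ms i + 1 ..< psum ms (i + 1) + 1]) [0..<length ms])"
    then obtain i where f: "f = cycle_of_list [psum ms i + 1 ..< psum ms (i + 1) + 1]"
      by auto
    have "set [psum ms i + 1 ..< psum ms (i + 1) + 1] \<subseteq> {1..n}"
      using le[of "i + 1"] by (simp only: set_upt) auto
    then show "f permutes {1..n}"
      unfolding f by (rule permutes_subset[OF cycle_permutes])
  qed
qed

end

theory Submission
  imports Defs "HOL-Combinatorics.Multiset_Permutations"
begin

text \<open>
  Delete the first edge of the first polygon. If it is glued to another edge of that polygon, the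
  polygon falls apart into two, and the genus inequality forces the surface to fall apart as well;
  the remaining faces are distributed over the two spheres. If it is glued to an edge of another
  polygon, the two merge into a polygon with \<open>i\<close> edges, and the original configuration is recovered
  by cutting the boundary word of the merged polygon into three consecutive, possibly empty, pieces,
  in \<open>(i + 1) (i + 2) / 2\<close> ways.

  To avoid renumbering, gluings are counted with their edges labelled by an arbitrary set of \<open>2 N\<close>
  labels: a face is the list of its labels starting at the distinguished edge, and every gluing datum
  has exactly \<open>(2 N)!\<close> labellings. The deletion does not change the number of vertices because a
  cycle \<open>(a, ys, b, zs)\<close> is the product of the transposition \<open>(a b)\<close> and the cycles \<open>(a, ys)\<close> and
  \<open>(b, zs)\<close>, so that the vertex permutation is conjugate to one for which \<open>a\<close> and \<open>b\<close> are fixed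
  by the matching.
\<close>

section \<open>Cycles of permutations and faces of a gluing\<close>

text \<open>Deleting the root edge can leave a polygon without edges and can increase the number of
  faces. Connectedness and Euler's formula are therefore set up for arbitrary multisets of lists,
  with \<open>[]\<close> allowed, and V - E + F <= 2 is proved for any number of faces. The
  coefficients arise as follows. When the first polygon is cut in two, the two other polygons go to
  the two pieces in four ways. One on each side occurs twice and gives products of two
  \<open>eps 0 _ 2\<close>; both on the same side also occurs twice, and reflecting the summation
  index shows that the two resulting sums agree. Hence the factor 2. When polygons merge, the
  partner is the second or the third one, and this second factor 2 clears the denominator of (i + 1)
  (i + 2) / 2. The factorials disappear because the root edge uses an ordered pair of labels, 2 N (2
  N - 1) choices, while the (2 N - 2)! labellings of the rest factor through a binomial coefficient
  if the rest consists of two spheres. So (2 N)! is common to all terms.\<close>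

lemma cycle_of_list_split:
  assumes "distinct (a # ys @ b # zs)"
  shows "cycle_of_list (a # ys @ b # zs)
    = transpose a b \<circ> cycle_of_list (a # ys) \<circ> cycle_of_list (b # zs)"
  using assms
proof (induction ys arbitrary: a)
  case Nil
  then show ?case by (simp add: comp_assoc)
next
  case (Cons y ys)
  \<comment> \<open>The relation (a y)(y b) = (a b)(a y) brings the transposition obtained for the
    shorter list to the front, in the form required for the longer one.\<close>
  have "transpose a y (transpose y b x) = transpose a b (transpose a y x)" for x
    using Cons.prems by (auto simp: transpose_def)
  moreover have "cycle_of_list (y # ys @ b # zs)
      = transpose y b \<circ> cycle_of_list (y # ys) \<circ> cycle_of_list (b # zs)"
    by (rule Cons.IH) (use Cons.prems in auto)
  ultimately show ?case
    by (simp add: fun_eq_iff)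
qed

lemma cycle_of_list_rotate:
  assumes "distinct (xs @ ys)"
  shows "cycle_of_list (ys @ xs) = cycle_of_list (xs @ ys)"
  using cycle_of_list_rotate_independent[OF assms, of "length xs"] by (simp add: rotate_append)

section \<open>Counting the cycles of a permutation\<close>

definition cycle_count :: "'a set \<Rightarrow> ('a \<Rightarrow> 'a) \<Rightarrow> nat" where
  "cycle_count A p = card (orbit p ` A)"

lemma orbit_image:
  assumes *: "\<And>x. q (g x) = g (p x)"
  shows "orbit q (g x) = g ` orbit p x"
proof (intro equalityI subsetI)
  fix y assume "y \<in> orbit q (g x)"
  then show "y \<in> g ` orbit p x"
    by induction (auto simp: * intro: orbit.intros)
next
  fix y assume "y \<in> g ` orbit p x"
  then obtain z where z: "y = g z" "z \<in> orbit p x" by auto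
  from z(2) have "g z \<in> orbit q (g x)"
  proof induction
    case base
    show ?case using orbit.base[of q "g x"] by (simp add: *)
  next
    case (step y)
    show ?case using orbit.step[OF step.IH] by (simp add: *)
  qed
  then show "y \<in> orbit q (g x)" by (simp add: z)
qed

text \<open>An injective map that intertwines \<open>p\<close> and \<open>q\<close> carries orbits
  to orbits and merges none. This serves both for conjugation by a transposition and for renaming
  labels.\<close>

lemma cycle_count_image:
  assumes "inj g" and "\<And>x. q (g x) = g (p x)"
  shows "cycle_count (g ` A) q = cycle_count A p"
proof -
  have "orbit q ` (g ` A) = (image g) ` (orbit p ` A)"
    using orbit_image[of q g p] assms(2) by (simp add: image_image)
  moreover have "inj (image g)"
    using assms(1) by (simp add: inj_def inj_image_eq_iff)
  ultimately show ?thesis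
    unfolding cycle_count_def by (metis card_image inj_on_subset subset_UNIV)
qed

lemma permutes_self_in_orbit: "p permutes A \<Longrightarrow> finite A \<Longrightarrow> x \<in> orbit p x"
  by (meson permutation_permutes permutation_self_in_orbit)

lemma orbit_eq_of_mem: "p permutes A \<Longrightarrow> finite A \<Longrightarrow> y \<in> orbit p x \<Longrightarrow> orbit p y = orbit p x"
  by (metis cyclic_on_orbit orbit_cyclic_eq3)

lemma orbit_eq_self: "p a = a \<Longrightarrow> orbit p a = {a}"
  by (simp add: orbit_eq_singleton_iff)

lemma cycle_count_insert_fixed:
  assumes "p permutes A" "finite A" "a \<notin> A"
  shows "cycle_count (insert a A) p = Suc (cycle_count A p)"
proof -
  have "p a = a" using assms by (simp add: permutes_not_in)
  then have "orbit p a = {a}" by (rule orbit_eq_self)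
  moreover have "{a} \<notin> orbit p ` A"
  proof
    assume "{a} \<in> orbit p ` A"
    then obtain x where "x \<in> A" "orbit p x = {a}" by auto
    with permutes_self_in_orbit[OF assms(1,2), of x] assms(3) show False by auto
  qed
  ultimately show ?thesis using assms(2) by (simp add: cycle_count_def)
qed

text \<open>Inserting a point \<open>a\<close> into the cycle through \<open>c\<close>.\<close>

lemma cycle_count_insert_transpose:
  assumes p: "p permutes A" and fin: "finite A" and a: "a \<notin> A" and c: "c \<in> A"
  shows "cycle_count (insert a A) (transpose a c \<circ> p) = cycle_count A p"
proof -
  define q where "q = transpose a c \<circ> p"
  have pa: "p a = a" using p a by (simp add: permutes_not_in)
  have q: "q permutes insert a A"
    unfolding q_def
    using permutes_compose[OF permutes_subset[OF p] permutes_swap_id[of a "insert a A" c]] c by auto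
  have finI: "finite (insert a A)" using fin by simp
  have ac: "a \<noteq> c" using a c by auto
  have qa: "q a = c" using pa by (simp add: q_def)
  have qx: "q x = (if p x = c then a else p x)" if "x \<in> A" for x
  proof -
    have "p x \<in> A" using p that by (simp add: permutes_in_image)
    then show ?thesis using a by (auto simp: q_def transpose_def)
  qed
  have orb: "orbit p x \<subseteq> A" if "x \<in> A" for x
    using p that by (rule permutes_orbit_subset)
  have 1: "orbit q x - {a} = orbit p x" if x: "x \<in> A" for x
  proof (intro equalityI subsetI)
    fix y assume "y \<in> orbit q x - {a}"
    then have "y \<in> orbit q x" "y \<noteq> a" by auto
    \<comment> \<open>The induction needs a claim about \<open>a\<close> as well: \<open>q\<close>
      enters \<open>a\<close> only where \<open>p\<close> would enter \<open>c\<close>, and it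
      leaves \<open>a\<close> towards \<open>c\<close>.\<close>
    have "(y \<noteq> a \<longrightarrow> y \<in> orbit p x) \<and> (y = a \<longrightarrow> c \<in> orbit p x)"
      using \<open>y \<in> orbit q x\<close>
    proof induction
      case base
      then show ?case using qx[OF x] orbit.base[of p x] orb[OF x] a by auto
    next
      case (step y)
      show ?case
      proof (cases "y = a")
        case True
        then show ?thesis using step qa ac by auto
      next
        case False
        then have y: "y \<in> orbit p x" using step by simp
        then have "y \<in> A" using orb[OF x] by auto
        with orbit.step[OF y] show ?thesis using qx[of y] orb[OF x] a by auto
      qed
    qed
    with \<open>y \<noteq> a\<close> show "y \<in> orbit p x" by simp
  next
    fix y assume y: "y \<in> orbit p x"
    then have "y \<in> orbit q x"
    proof induction
      case base
      have "q x \<in> orbit q x" by (rule orbit.base)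
      moreover have "q (q x) \<in> orbit q x" by (intro orbit.step orbit.base)
      ultimately show ?case using qx[OF x] qa by (auto split: if_splits)
    next
      case (step y)
      then have "y \<in> A" using orb[OF x] by auto
      have "q y \<in> orbit q x" using step.IH by (rule orbit.step)
      moreover have "q (q y) \<in> orbit q x" by (intro orbit.step step.IH)
      ultimately show ?case using qx[OF \<open>y \<in> A\<close>] qa by (auto split: if_splits)
    qed
    then show "y \<in> orbit q x - {a}" using y orb[OF x] a by auto
  qed
  have "orbit q a = orbit q c"
    using orbit_eq_of_mem[OF q finI, of c a] qa orbit.base[of q a] by simp
  then have im: "orbit q ` insert a A = orbit q ` A" using c by auto
  \<comment> \<open>Orbits that agree after removal of \<open>a\<close> share a point of
    \<open>A\<close> and hence coincide.\<close>
  have "inj_on (\<lambda>X. X - {a}) (orbit q ` A)"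
  proof (rule inj_onI; clarify)
    fix x y assume xy: "x \<in> A" "y \<in> A" "orbit q x - {a} = orbit q y - {a}"
    then have "x \<in> orbit q y"
      using 1 permutes_self_in_orbit[OF p fin, of x] by auto
    then show "orbit q x = orbit q y" using orbit_eq_of_mem[OF q finI] by simp
  qed
  then have "card (orbit q ` A) = card ((\<lambda>X. X - {a}) ` orbit q ` A)"
    by (simp add: card_image)
  also have "(\<lambda>X. X - {a}) ` orbit q ` A = orbit p ` A"
    unfolding image_image using 1 by (intro image_cong) auto
  finally show ?thesis unfolding cycle_count_def q_def[symmetric] im .
qed

lemma cycle_count_cong:
  assumes p: "p permutes A" and fin: "finite A" and eq: "\<And>x. x \<in> A \<Longrightarrow> p x = q x"
  shows "cycle_count A p = cycle_count A q"
proof -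
  have "orbit p x = orbit q x" if "x \<in> A" for x
  proof (rule orbit_cong0[of x A])
    show "p \<in> A \<rightarrow> A" using p by (auto simp: permutes_in_image)
  qed (use that eq in auto)
  then show ?thesis unfolding cycle_count_def by (metis image_cong)
qed

lemma cycle_count_disjoint_Un:
  assumes p: "p permutes A \<union> B" "finite (A \<union> B)" and disj: "A \<inter> B = {}" and pA: "p ` A \<subseteq> A"
  shows "cycle_count (A \<union> B) p = cycle_count A p + cycle_count B p"
proof -
  have sub: "orbit p x \<subseteq> A" if "x \<in> A" for x
  proof
    fix y assume "y \<in> orbit p x"
    then show "y \<in> A" using that pA by induction auto
  qed
  have "orbit p ` A \<inter> orbit p ` B = {}"
  proof (rule ccontr)
    assume "orbit p ` A \<inter> orbit p ` B \<noteq> {}"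
    then obtain x y where "x \<in> A" "y \<in> B" "orbit p x = orbit p y" by auto
    with permutes_self_in_orbit[OF p, of y] sub disj show False by auto
  qed
  then show ?thesis unfolding cycle_count_def using p(2)
    by (simp add: image_Un card_Un_disjoint)
qed

section \<open>Faces as a multiset of label lists, and the face permutation\<close>

definition darts :: "'a list multiset \<Rightarrow> 'a multiset" where
  "darts M = sum_mset (image_mset mset M)"

abbreviation dset :: "'a list multiset \<Rightarrow> 'a set" where
  "dset M \<equiv> set_mset (darts M)"

text \<open>Bounding multiplicities excludes repetitions inside a face and labels shared by two
  faces in one condition, while several empty faces remain admissible.\<close>

definition simple :: "'a list multiset \<Rightarrow> bool" where
  "simple M \<longleftrightarrow> (\<forall>x. count (darts M) x \<le> 1)"

lemma darts_simps [simp]: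
  "darts {#} = {#}" "darts (add_mset xs M) = mset xs + darts M" "darts (M + M') = darts M + darts M'"
  by (simp_all add: darts_def)

lemma dset_iff: "x \<in> dset M \<longleftrightarrow> (\<exists>xs \<in># M. x \<in> set xs)"
  by (induction M) auto

lemma simple_add_mset:
  "simple (add_mset xs M) \<longleftrightarrow> distinct xs \<and> set xs \<inter> dset M = {} \<and> simple M"
proof
  assume *: "simple (add_mset xs M)"
  have c: "count (mset xs) x + count (darts M) x \<le> 1" for x
    using * by (simp add: simple_def)
  have "count (mset xs) x = (if x \<in> set xs then 1 else 0)" for x
    using c[of x] count_greater_zero_iff[of "mset xs" x]
    by (cases "x \<in> set xs") (simp_all del: count_greater_zero_iff)
  then have "distinct xs"
    by (simp add: distinct_count_atmost_1)
  moreover have "set xs \<inter> dset M = {}"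
  proof (rule ccontr)
    assume "set xs \<inter> dset M \<noteq> {}"
    then obtain x where "x \<in># mset xs" "x \<in># darts M" by auto
    then have "count (mset xs) x \<ge> 1" "count (darts M) x \<ge> 1"
      by (simp_all only: count_greater_eq_one_iff)
    with c[of x] show False by simp
  qed
  moreover have "simple M" unfolding simple_def using c by (meson add_leE)
  ultimately show "distinct xs \<and> set xs \<inter> dset M = {} \<and> simple M" by simp
next
  assume *: "distinct xs \<and> set xs \<inter> dset M = {} \<and> simple M"
  then have "count (mset xs) x + count (darts M) x \<le> 1" for x
    by (cases "x \<in> set xs") (auto simp: simple_def distinct_count_atmost_1 not_in_iff disjoint_iff
        dest: bspec)
  then show "simple (add_mset xs M)" by (simp add: simple_def)
qed

lemma simple_empty [simp]: "simple {#}"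
  by (simp add: simple_def)

lemma simple_union:
  "simple (M + M') \<longleftrightarrow> simple M \<and> simple M' \<and> dset M \<inter> dset M' = {}"
  by (induction M) (auto simp: simple_add_mset)

lemma simple_mset: "simple (mset Fs) \<longleftrightarrow> distinct (concat Fs)"
  and dset_mset: "dset (mset Fs) = set (concat Fs)"
  by (induction Fs) (auto simp: simple_add_mset)

lemma card_dset: "simple M \<Longrightarrow> card (dset M) = size (darts M)"
  by (induction M) (auto simp: simple_add_mset card_Un_disjoint distinct_card)

text \<open>A multiset has no order in which the cycles could be composed, so the face containing
  \<open>x\<close> is chosen instead; for \<open>simple M\<close> it is unique.\<close>

definition face_map :: "'a list multiset \<Rightarrow> 'a \<Rightarrow> 'a" where
  "face_map M x = (if x \<in> dset M then cycle_of_list (SOME xs. xs \<in># M \<and> x \<in> set xs) x else x)"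

lemma face_map_in:
  assumes "simple M" "xs \<in># M" "x \<in> set xs"
  shows "face_map M x = cycle_of_list xs x"
proof -
  obtain M' where M: "M = add_mset xs M'" using assms(2) by (metis multi_member_split)
  have uniq: "ys = xs" if "ys \<in># M" "x \<in> set ys" for ys
    using that assms(1,3) dset_iff[of x M'] unfolding M by (auto simp: simple_add_mset)
  have "(SOME ys. ys \<in># M \<and> x \<in> set ys) = xs"
    by (rule some_equality) (use assms uniq in blast)+
  then show ?thesis using assms by (auto simp: face_map_def dset_iff)
qed

text \<open>Recovers the product of disjoint cycles from the pointwise definition, and with it the
  possibility to split or shorten a single cycle.\<close>

lemma face_map_add_mset:
  assumes "simple (add_mset xs M)"
  shows "face_map (add_mset xs M) = cycle_of_list xs \<circ> face_map M"
proof
  fix x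
  have M: "simple M" and disj: "set xs \<inter> dset M = {}" using assms by (auto simp: simple_add_mset)
  consider "x \<in> set xs" | ys where "ys \<in># M" "x \<in> set ys" | "x \<notin> dset (add_mset xs M)"
    using dset_iff[of x M] by auto
  then show "face_map (add_mset xs M) x = (cycle_of_list xs \<circ> face_map M) x"
  proof cases
    case 1
    then have "face_map M x = x" using disj by (auto simp: face_map_def)
    then show ?thesis using 1 face_map_in[OF assms, of xs x] by simp
  next
    case 2
    then have "cycle_of_list ys x \<in> set ys"
      by (meson cycle_permutes permutes_in_image)
    then have "cycle_of_list ys x \<notin> set xs"
      using disj 2(1) by (metis disjoint_iff dset_iff)
    then show ?thesis
      using 2 face_map_in[OF assms, of ys x] face_map_in[OF M 2] by (simp add: id_outside_supp)
  next
    case 3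
    then show ?thesis by (simp add: face_map_def id_outside_supp)
  qed
qed

lemma face_map_empty [simp]: "face_map {#} = id"
  by (rule ext, simp add: face_map_def)

lemma face_map_permutes: "simple M \<Longrightarrow> face_map M permutes dset M"
proof (induction M)
  case empty
  show ?case unfolding face_map_empty by (rule permutes_id)
next
  case (add xs M)
  then have IH: "face_map M permutes dset M" by (simp add: simple_add_mset)
  show ?case unfolding face_map_add_mset[OF add.prems]
    by (rule permutes_compose) (use IH cycle_permutes in \<open>auto intro: permutes_subset\<close>)
qed

text \<open>An empty face counts as one vertex, so that a polygon with no edges is a sphere with one face
  and one vertex.\<close>

definition vertices :: "'a list multiset \<Rightarrow> ('a \<Rightarrow> 'a) \<Rightarrow> nat" where
  "vertices M \<iota> = cycle_count (dset M) (face_map M \<circ> \<iota>) + count M []"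

lemma vertices_rotate:
  assumes "simple (add_mset (xs @ ys) M)"
  shows "vertices (add_mset (ys @ xs) M) \<iota> = vertices (add_mset (xs @ ys) M) \<iota>"
proof -
  have s: "simple (add_mset (ys @ xs) M)" using assms by (auto simp: simple_add_mset)
  have "cycle_of_list (ys @ xs) = cycle_of_list (xs @ ys)"
    using assms by (intro cycle_of_list_rotate) (simp add: simple_add_mset)
  then show ?thesis
    using face_map_add_mset[OF assms] face_map_add_mset[OF s] by (auto simp: vertices_def Un_commute)
qed

text \<open>If the face has a further dart \<open>c\<close> after \<open>a\<close>, then
  \<open>a\<close> is merely an extra point inserted in the vertex cycle through \<open>c\<close>.
  If \<open>a\<close> is alone, its own cycle disappears, and the empty face left behind is counted
  in its place.\<close>

lemma vertices_remove_fixed: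
  assumes s: "simple (add_mset (a # ys) M)" and i: "\<iota> permutes dset (add_mset (a # ys) M)" 
    and a: "\<iota> a = a"
  shows "vertices (add_mset (a # ys) M) \<iota> = vertices (add_mset ys M) \<iota>"
proof -
  have s': "simple (add_mset ys M)" and aA: "a \<notin> dset (add_mset ys M)"
    using s by (auto simp: simple_add_mset)
  have "\<iota> permutes dset (add_mset ys M)"
    using i a by (intro permutes_superset[OF i]) auto
  then have p: "face_map (add_mset ys M) \<circ> \<iota> permutes dset (add_mset ys M)"
    using face_map_permutes[OF s'] by (rule permutes_compose)
  show ?thesis
  proof (cases ys)
    case Nil
    then have "face_map (add_mset (a # ys) M) = face_map (add_mset ys M)"
      using face_map_add_mset[OF s] face_map_add_mset[OF s'] by simp
    then show ?thesis
      using cycle_count_insert_fixed[OF p _ aA] Nil by (simp add: vertices_def)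
  next
    case (Cons c cs)
    then have "face_map (add_mset (a # ys) M) = transpose a c \<circ> face_map (add_mset ys M)"
      using face_map_add_mset[OF s] face_map_add_mset[OF s'] by (simp add: comp_assoc)
    then show ?thesis
      using cycle_count_insert_transpose[OF p _ aA, of c] Cons by (simp add: vertices_def comp_assoc)
  qed
qed

section \<open>The number of vertices when the root edge is removed\<close>

lemma transpose_comp_involution:
  assumes "\<iota> permutes A" "\<iota> a = b" "\<iota> b = a"
  shows "transpose a b \<circ> \<iota> = \<iota> \<circ> transpose a b"
proof
  fix x
  have "inj \<iota>" using assms(1) by (rule permutes_inj)
  then have "\<iota> x = b \<longleftrightarrow> x = a" "\<iota> x = a \<longleftrightarrow> x = b"
    using assms(2,3) by (metis injD)+
  then show "(transpose a b \<circ> \<iota>) x = (\<iota> \<circ> transpose a b) x"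
    using assms by (auto simp: transpose_def)
qed

lemma transpose_comp_involution_permutes:
  assumes "\<iota> permutes A" "\<iota> a = b" "\<iota> b = a" "a \<in> A"
  shows "transpose a b \<circ> \<iota> permutes A"
proof -
  have "b \<in> A" using assms by (metis permutes_in_image)
  then show ?thesis using assms by (intro permutes_compose permutes_swap_id) auto
qed

lemma face_map_add_mset_split:
  assumes s: "simple (add_mset (a # ys) (add_mset (b # zs) M))"
  shows "face_map (add_mset (a # ys @ b # zs) M)
    = transpose a b \<circ> face_map (add_mset (a # ys) (add_mset (b # zs) M))"
proof -
  have s1: "simple (add_mset (b # zs) M)" using s unfolding simple_add_mset by blast
  have s2: "simple (add_mset (a # ys @ b # zs) M)" using s by (auto simp: simple_add_mset)
  have "distinct (a # ys @ b # zs)" using s2 unfolding simple_add_mset by blast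
  from cycle_of_list_split[OF this] show ?thesis
    unfolding face_map_add_mset[OF s] face_map_add_mset[OF s1] face_map_add_mset[OF s2]
    by (simp add: comp_assoc)
qed

text \<open>Since \<open>\<iota>\<close> commutes with t = (a b), one has t f \<open>\<iota>\<close>
  = t (f t \<open>\<iota>\<close>) t for the face permutation f: a factor t of the face permutation
  may be moved to the matching, up to conjugation. The first form is for splitting a face, the
  second for merging two.\<close>

lemma vertices_transpose:
  assumes s: "simple M" "simple M'" and d: "dset M = dset M'" and c: "count M [] = count M' []"
    and fm: "face_map M' = transpose a b \<circ> face_map M"
    and i: "\<iota> permutes dset M" "\<iota> a = b" "\<iota> b = a"
  shows "vertices M' \<iota> = vertices M (transpose a b \<circ> \<iota>)"
    and "vertices M \<iota> = vertices M' (transpose a b \<circ> \<iota>)"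
proof -
  let ?t = "transpose a b"
  have comm: "?t \<circ> \<iota> = \<iota> \<circ> ?t" using i by (rule transpose_comp_involution)
  have im: "?t ` dset M = dset M"
  proof (cases "a \<in> dset M")
    case True
    then have "b \<in> dset M" using i by (metis permutes_in_image)
    with True show ?thesis by (meson permutes_image permutes_swap_id)
  next
    case False
    then have "a = b" using i by (metis permutes_not_in)
    then show ?thesis by simp
  qed
  have *: "cycle_count (dset M) (?t \<circ> p \<circ> ?t) = cycle_count (dset M) p" for p
    using cycle_count_image[of ?t "?t \<circ> p \<circ> ?t" p "dset M"] im by simp
  have tt: "?t \<circ> (?t \<circ> p) = p" for p :: "'a \<Rightarrow> 'a" by (auto simp: fun_eq_iff)
  have "face_map M' \<circ> \<iota> = ?t \<circ> (face_map M \<circ> (?t \<circ> \<iota>)) \<circ> ?t"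
    unfolding fm comm by (simp add: comp_assoc)
  then show "vertices M' \<iota> = vertices M (?t \<circ> \<iota>)" using * d c by (simp add: vertices_def)
  have "face_map M \<circ> \<iota> = ?t \<circ> (face_map M' \<circ> (?t \<circ> \<iota>)) \<circ> ?t"
    unfolding fm comm by (simp add: comp_assoc tt)
  then show "vertices M \<iota> = vertices M' (?t \<circ> \<iota>)" using * d c by (simp add: vertices_def)
qed

lemma vertices_cut_loop:
  assumes s: "simple (add_mset (a # ys @ b # zs) M)"
    and i: "\<iota> permutes dset (add_mset (a # ys @ b # zs) M)" "\<iota> a = b" "\<iota> b = a"
  shows "vertices (add_mset (a # ys @ b # zs) M) \<iota>
    = vertices (add_mset ys (add_mset zs M)) (transpose a b \<circ> \<iota>)"
proof -
  let ?N = "add_mset (a # ys) (add_mset (b # zs) M)"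
  let ?i = "transpose a b \<circ> \<iota>"
  have sN: "simple ?N" using s by (auto simp: simple_add_mset)
  have d: "dset ?N = dset (add_mset (a # ys @ b # zs) M)" by auto
  have pi: "?i permutes dset ?N" unfolding d using i 
    by (intro transpose_comp_involution_permutes) auto
  have fx: "?i a = a" "?i b = b" using i by simp_all
  have "vertices (add_mset (a # ys @ b # zs) M) \<iota> = vertices ?N ?i"
    by (rule vertices_transpose(1)[OF sN s d _ face_map_add_mset_split[OF sN]])
      (use i d in auto)
  also have "\<dots> = vertices (add_mset ys (add_mset (b # zs) M)) ?i"
    by (rule vertices_remove_fixed[OF sN pi fx(1)])
  also have "\<dots> = vertices (add_mset (b # zs) (add_mset ys M)) ?i" by (simp add: add_mset_commute)
  also have "\<dots> = vertices (add_mset zs (add_mset ys M)) ?i"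
  proof (rule vertices_remove_fixed[where a = b])
    show "simple (add_mset (b # zs) (add_mset ys M))" using s by (auto simp: simple_add_mset)
    show "?i permutes dset (add_mset (b # zs) (add_mset ys M))"
      by (rule permutes_superset[OF pi]) (use fx in auto)
    show "?i b = b" by (rule fx)
  qed
  finally show ?thesis by (simp add: add_mset_commute)
qed

text \<open>Read cyclically from \<open>b\<close>, the second face is \<open>b # vs @ us\<close>;
  this is why \<open>vs\<close> precedes \<open>us\<close> in the merged word.\<close>

lemma vertices_cut_bridge:
  assumes s: "simple (add_mset (a # ys) (add_mset (us @ b # vs) M))"
    and i: "\<iota> permutes dset (add_mset (a # ys) (add_mset (us @ b # vs) M))" "\<iota> a = b" "\<iota> b = a"
  shows "vertices (add_mset (a # ys) (add_mset (us @ b # vs) M)) \<iota>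
    = vertices (add_mset (ys @ vs @ us) M) (transpose a b \<circ> \<iota>)"
proof -
  let ?N = "add_mset (a # ys) (add_mset (b # vs @ us) M)"
  let ?W = "add_mset (a # ys @ b # vs @ us) M"
  let ?i = "transpose a b \<circ> \<iota>"
  have sN: "simple ?N" and sW: "simple ?W" using s by (auto simp: simple_add_mset)
  have d: "dset ?N = dset ?W" "dset (add_mset (a # ys) (add_mset (us @ b # vs) M)) = dset ?W"
    by auto
  have pi: "?i permutes dset ?W" using i unfolding d
    by (intro transpose_comp_involution_permutes) auto
  have fx: "?i a = a" "?i b = b" using i by simp_all
  have "vertices (add_mset (a # ys) (add_mset (us @ b # vs) M)) \<iota> = vertices ?N \<iota>"
    using vertices_rotate[of us "b # vs" "add_mset (a # ys) M" \<iota>] s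
    by (simp add: add_mset_commute)
  also have "\<dots> = vertices ?W ?i"
    by (rule vertices_transpose(2)[OF sN sW d(1) _ face_map_add_mset_split[OF sN]])
      (use i d in auto)
  \<comment> \<open>Only the head of a face can be removed, so \<open>b\<close> and then
    \<open>a\<close> are rotated to the front.\<close>
  also have "\<dots> = vertices (add_mset (b # vs @ us @ a # ys) M) ?i"
    using vertices_rotate[of "a # ys" "b # vs @ us" M] sW by simp
  also have "\<dots> = vertices (add_mset (vs @ us @ a # ys) M) ?i"
    by (rule vertices_remove_fixed) (use sW pi fx in \<open>auto simp: simple_add_mset Un_ac insert_commute\<close>)
  also have "\<dots> = vertices (add_mset (a # ys @ vs @ us) M) ?i"
    using vertices_rotate[of "a # ys" "vs @ us" M] sW by (auto simp: simple_add_mset)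
  also have "\<dots> = vertices (add_mset (ys @ vs @ us) M) ?i"
  proof (rule vertices_remove_fixed[where a = a])
    show "simple (add_mset (a # ys @ vs @ us) M)" using sW by (auto simp: simple_add_mset)
    show "?i permutes dset (add_mset (a # ys @ vs @ us) M)"
      by (rule permutes_superset[OF pi]) (use fx in auto)
    show "?i a = a" by (rule fx)
  qed
  finally show ?thesis .
qed

section \<open>Connectedness and the genus inequality\<close>

text \<open>Points outside \<open>A\<close> are fixed, so a matching is determined by its values on
  \<open>A\<close>, and matchings of disjoint sets combine by composition.\<close>

definition matching :: "'a set \<Rightarrow> ('a \<Rightarrow> 'a) \<Rightarrow> bool" where
  "matching A \<iota> \<longleftrightarrow> (\<forall>x. \<iota> (\<iota> x) = x) \<and> (\<forall>x. \<iota> x = x \<longleftrightarrow> x \<notin> A)"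

lemma matching_permutes:
  assumes "matching A \<iota>" shows "\<iota> permutes A"
  unfolding permutes_def using assms unfolding matching_def by metis

lemma matching_simps:
  assumes "matching A \<iota>"
  shows "\<iota> (\<iota> x) = x" "\<iota> x = x \<longleftrightarrow> x \<notin> A" "\<iota> x \<in> A \<longleftrightarrow> x \<in> A"
  using assms matching_permutes[OF assms] by (auto simp: matching_def permutes_in_image)

lemma matching_cut:
  assumes m: "matching A \<iota>" and a: "a \<in> A" and b: "\<iota> a = b"
  shows "matching (A - {a, b}) (transpose a b \<circ> \<iota>)"
proof -
  have b': "\<iota> b = a" "a \<noteq> b" using matching_simps(1,2)[OF m, of a] a b by auto
  have off: "\<iota> x \<noteq> a" "\<iota> x \<noteq> b" if "x \<noteq> a" "x \<noteq> b" for x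
    using that matching_simps[OF m] b b' by metis+
  have val: "(transpose a b \<circ> \<iota>) x = (if x = a \<or> x = b then x else \<iota> x)" for x
    using off b b' by auto
  show ?thesis unfolding matching_def val
    using matching_simps[OF m] off by (auto)
qed

lemma matching_restrict:
  assumes m: "matching A \<iota>" and B: "B \<subseteq> A" "\<iota> ` B \<subseteq> B"
  shows "matching B (perm_restrict \<iota> B)"
  using B matching_simps[OF m] by (auto simp: matching_def perm_restrict_def)

lemma matching_complement_closed:
  assumes "matching A \<iota>" "B \<subseteq> A" "B \<inter> C = {}" "B \<union> C = A" "\<iota> ` B \<subseteq> B"
  shows "\<iota> ` C \<subseteq> C"
proof
  fix y assume "y \<in> \<iota> ` C"
  then obtain x where x: "x \<in> C" "y = \<iota> x" by auto
  then have "y \<in> A" using matching_simps[OF assms(1)] assms by auto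
  moreover have "y \<notin> B" using matching_simps[OF assms(1)] assms x by (metis disjoint_iff image_subset_iff)
  ultimately show "y \<in> C" using assms by auto
qed

text \<open>Splitting the multiset of faces, rather than the set of darts, makes every empty face a component
  of its own.\<close>

definition conn :: "'a list multiset \<Rightarrow> ('a \<Rightarrow> 'a) \<Rightarrow> bool" where
  "conn M \<iota> \<longleftrightarrow> M \<noteq> {#} \<and>
     (\<forall>G H. M = G + H \<longrightarrow> \<iota> ` dset G \<subseteq> dset G \<longrightarrow> G = {#} \<or> H = {#})"

text \<open>The complement of a set closed under an involution is closed, so of the two parts of a
  splitting one may always test the part that contains the given face \<open>F\<close>.\<close>

lemma conn_add_mset:
  assumes s: "simple (add_mset F M)" and m: "matching (dset (add_mset F M)) \<iota>"
  shows "conn (add_mset F M) \<iota> \<longleftrightarrow> (\<forall>G H. M = G + H \<longrightarrow>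
     \<iota> ` dset (add_mset F G) \<subseteq> dset (add_mset F G) \<longrightarrow> H = {#})"
proof
  assume c: "conn (add_mset F M) \<iota>"
  have "H = {#}" if "M = G + H" "\<iota> ` dset (add_mset F G) \<subseteq> dset (add_mset F G)" for G H
  proof -
    have "add_mset F M = add_mset F G + H" using that by simp
    then have "add_mset F G = {#} \<or> H = {#}" using c that unfolding conn_def by blast
    then show ?thesis by simp
  qed
  then show "\<forall>G H. M = G + H \<longrightarrow>
     \<iota> ` dset (add_mset F G) \<subseteq> dset (add_mset F G) \<longrightarrow> H = {#}" by blast
next
  assume *: "\<forall>G H. M = G + H \<longrightarrow>
     \<iota> ` dset (add_mset F G) \<subseteq> dset (add_mset F G) \<longrightarrow> H = {#}"
  have "G = {#} \<or> H = {#}" if GH: "add_mset F M = G + H" and cl: "\<iota> ` dset G \<subseteq> dset G" for G H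
  proof (cases "F \<in># G")
    case True
    then obtain G' where G: "G = add_mset F G'" by (meson multi_member_split)
    then have "M = G' + H" using GH by simp
    then show ?thesis using * cl unfolding G by blast
  next
    case False
    then have "F \<in># H" using GH by (metis union_iff union_single_eq_member)
    then obtain H' where H: "H = add_mset F H'" by (meson multi_member_split)
    then have M: "M = H' + G" using GH by (simp add: add.commute)
    have "dset G \<inter> dset H = {}" "dset G \<union> dset H = dset (add_mset F M)"
      using s unfolding GH simple_union by auto
    then have "\<iota> ` dset H \<subseteq> dset H"
      using matching_complement_closed[OF m _ _ _ cl] by blast
    then show ?thesis using * M unfolding H by blast
  qed
  then show "conn (add_mset F M) \<iota>" unfolding conn_def by auto
qed

text \<open>The Riesz refinement of two splittings. The two-by-two table is filled greedily: as much
  of \<open>P\<close> as possible goes into \<open>G\<close>, and \<open>Q\<close> supplies the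
  remainder of \<open>G\<close>.\<close>

lemma add_eq_add_refine:
  fixes G :: "'a multiset"
  assumes "P + Q = G + H"
  obtains P1 P2 Q1 Q2 where "P = P1 + P2" "Q = Q1 + Q2" "G = P1 + Q1" "H = P2 + Q2"
proof
  have c: "count P x + count Q x = count G x + count H x" for x
    using arg_cong[OF assms, of "\<lambda>M. count M x"] by simp
  show "P = P \<inter># G + (P - G)" by (rule multiset_eqI) simp
  show "Q = (G - P) + (Q - (G - P))"   proof (rule multiset_eqI)
    fix x show "count Q x = count ((G - P) + (Q - (G - P))) x" using c[of x] by simp
  qed
  show "G = P \<inter># G + (G - P)" by (rule multiset_eqI) simp
  show "H = (P - G) + (Q - (G - P))"
  proof (rule multiset_eqI)
    fix x show "count H x = count ((P - G) + (Q - (G - P))) x" using c[of x] by simp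
  qed
qed

lemma image_pair_Un_subset:
  assumes "f a = b" "f b = a" "f ` A \<subseteq> A" "f ` B \<subseteq> B"
  shows "f ` ({a, b} \<union> A \<union> B) \<subseteq> {a, b} \<union> A \<union> B"
  using assms by auto

lemma image_Int_subset_of_closed:
  "f ` A \<subseteq> A \<Longrightarrow> f ` B \<subseteq> B \<Longrightarrow> f ` (A \<inter> B) \<subseteq> A \<inter> B"
  by auto

text \<open>Only the root face connects the two sides. A closed part on one side that contains its
  piece of that face becomes a closed part of the whole once the root face and the entire other side
  are added; conversely, a closed part containing the root face restricts to a closed part on each
  side.\<close>

lemma conn_cut_loop:
  assumes s: "simple (add_mset (a # ys @ b # zs) (G + H))"
    and m: "matching (dset (add_mset (a # ys @ b # zs) (G + H))) \<iota>" and ab: "\<iota> a = b"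
    and cl: "\<iota> ` dset (add_mset ys G) \<subseteq> dset (add_mset ys G)"
  shows "\<iota> ` dset (add_mset zs H) \<subseteq> dset (add_mset zs H)"
    and "conn (add_mset (a # ys @ b # zs) (G + H)) \<iota>
      \<longleftrightarrow> conn (add_mset ys G) (perm_restrict \<iota> (dset (add_mset ys G)))
        \<and> conn (add_mset zs H) (perm_restrict \<iota> (dset (add_mset zs H)))"
proof -
  let ?F = "a # ys @ b # zs" and ?Y = "add_mset ys G" and ?Z = "add_mset zs H"
  let ?S = "add_mset ?F (G + H)"
  have ba: "\<iota> b = a" using matching_simps[OF m] ab by metis
  have sY: "simple ?Y" and sZ: "simple ?Z" and disj: "dset ?Y \<inter> dset ?Z = {}"
    and abn: "a \<notin> dset ?Y" "a \<notin> dset ?Z" "b \<notin> dset ?Y" "b \<notin> dset ?Z"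
    using s by (auto simp: simple_add_mset simple_union)
  have dS: "dset ?S = {a, b} \<union> dset ?Y \<union> dset ?Z" by auto
  show clZ: "\<iota> ` dset ?Z \<subseteq> dset ?Z"
    by (rule matching_complement_closed[OF m, of "{a, b} \<union> dset ?Y"])
      (use dS disj abn cl ab ba in auto)
  have mY: "matching (dset ?Y) (perm_restrict \<iota> (dset ?Y))"
    and mZ: "matching (dset ?Z) (perm_restrict \<iota> (dset ?Z))"
    by (rule matching_restrict[OF m _ cl], force) (rule matching_restrict[OF m _ clZ], force)
  have cong: "perm_restrict \<iota> A ` B = \<iota> ` B" if "B \<subseteq> A" for A B
    using that by (intro image_cong) (auto simp: perm_restrict_def)
  have Y: "conn ?Y (perm_restrict \<iota> (dset ?Y)) \<longleftrightarrow> (\<forall>G1 G2. G = G1 + G2 \<longrightarrow>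
     \<iota> ` dset (add_mset ys G1) \<subseteq> dset (add_mset ys G1) \<longrightarrow> G2 = {#})"
    unfolding conn_add_mset[OF sY mY]
  proof (intro iff_allI imp_cong[OF refl])
    fix G1 G2 assume "G = G1 + G2"
    then have "dset (add_mset ys G1) \<subseteq> dset ?Y" by auto
    from cong[OF this]
    show "(perm_restrict \<iota> (dset ?Y) ` dset (add_mset ys G1) \<subseteq> dset (add_mset ys G1)
        \<longrightarrow> G2 = {#}) \<longleftrightarrow> (\<iota> ` dset (add_mset ys G1) \<subseteq> dset (add_mset ys G1)
        \<longrightarrow> G2 = {#})" by (simp only:)
  qed
  have Z: "conn ?Z (perm_restrict \<iota> (dset ?Z)) \<longleftrightarrow> (\<forall>H1 H2. H = H1 + H2 \<longrightarrow>
     \<iota> ` dset (add_mset zs H1) \<subseteq> dset (add_mset zs H1) \<longrightarrow> H2 = {#})"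
    unfolding conn_add_mset[OF sZ mZ]
  proof (intro iff_allI imp_cong[OF refl])
    fix H1 H2 assume "H = H1 + H2"
    then have "dset (add_mset zs H1) \<subseteq> dset ?Z" by auto
    from cong[OF this]
    show "(perm_restrict \<iota> (dset ?Z) ` dset (add_mset zs H1) \<subseteq> dset (add_mset zs H1)
        \<longrightarrow> H2 = {#}) \<longleftrightarrow> (\<iota> ` dset (add_mset zs H1) \<subseteq> dset (add_mset zs H1)
        \<longrightarrow> H2 = {#})" by (simp only:)
  qed
  show "conn ?S \<iota> \<longleftrightarrow> conn ?Y (perm_restrict \<iota> (dset ?Y)) \<and> conn ?Z (perm_restrict \<iota> (dset ?Z))"
    unfolding conn_add_mset[OF s m] Y Z
  proof (intro iffI conjI allI impI)
    fix G1 G2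
    assume *: "\<forall>P Q. G + H = P + Q \<longrightarrow>
      \<iota> ` dset (add_mset ?F P) \<subseteq> dset (add_mset ?F P) \<longrightarrow> Q = {#}"
      and G: "G = G1 + G2" and cl1: "\<iota> ` dset (add_mset ys G1) \<subseteq> dset (add_mset ys G1)"
    have "\<iota> ` ({a, b} \<union> dset (add_mset ys G1) \<union> dset ?Z)
        \<subseteq> {a, b} \<union> dset (add_mset ys G1) \<union> dset ?Z"
      by (rule image_pair_Un_subset[OF ab ba cl1 clZ])
    moreover have "dset (add_mset ?F (G1 + H)) = {a, b} \<union> dset (add_mset ys G1) \<union> dset ?Z" by auto
    ultimately show "G2 = {#}" using *[rule_format, of "G1 + H" G2] by (simp add: G ac_simps)
  next
    fix H1 H2
    assume *: "\<forall>P Q. G + H = P + Q \<longrightarrow>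
      \<iota> ` dset (add_mset ?F P) \<subseteq> dset (add_mset ?F P) \<longrightarrow> Q = {#}"
      and H: "H = H1 + H2" and cl1: "\<iota> ` dset (add_mset zs H1) \<subseteq> dset (add_mset zs H1)"
    have "\<iota> ` ({a, b} \<union> dset (add_mset zs H1) \<union> dset ?Y)
        \<subseteq> {a, b} \<union> dset (add_mset zs H1) \<union> dset ?Y"
      by (rule image_pair_Un_subset[OF ab ba cl1 cl])
    moreover have "dset (add_mset ?F (G + H1)) = {a, b} \<union> dset (add_mset zs H1) \<union> dset ?Y" by auto
    ultimately show "H2 = {#}" using *[rule_format, of "G + H1" H2] by (simp add: H ac_simps)
  next
    fix P Q
    assume *: "(\<forall>G1 G2. G = G1 + G2 \<longrightarrow>
        \<iota> ` dset (add_mset ys G1) \<subseteq> dset (add_mset ys G1) \<longrightarrow> G2 = {#}) \<and>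
      (\<forall>H1 H2. H = H1 + H2 \<longrightarrow>
        \<iota> ` dset (add_mset zs H1) \<subseteq> dset (add_mset zs H1) \<longrightarrow> H2 = {#})"
      and PQ: "G + H = P + Q" and clP: "\<iota> ` dset (add_mset ?F P) \<subseteq> dset (add_mset ?F P)"
    obtain P1 P2 Q1 Q2 where r: "P = P1 + P2" "Q = Q1 + Q2" "G = P1 + Q1" "H = P2 + Q2"
      using add_eq_add_refine[of P Q G H] PQ by metis
    \<comment> \<open>Both restrictions are intersections of closed sets of darts, and hence
      closed.\<close>
    have "dset (add_mset ys P1) = dset ?Y \<inter> dset (add_mset ?F P)"
      "dset (add_mset zs P2) = dset ?Z \<inter> dset (add_mset ?F P)"
      using s unfolding r by (auto simp: simple_add_mset simple_union)
    then have "\<iota> ` dset (add_mset ys P1) \<subseteq> dset (add_mset ys P1)"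
      "\<iota> ` dset (add_mset zs P2) \<subseteq> dset (add_mset zs P2)"
      using image_Int_subset_of_closed[OF cl clP] image_Int_subset_of_closed[OF clZ clP] by simp_all
    then have "Q1 = {#}" "Q2 = {#}" using * r by blast+
    then show "Q = {#}" using r by simp
  qed
qed

text \<open>A splitting of the cut surface must put \<open>ys\<close> and \<open>zs\<close> on
  different sides. \<open>G\<close> then consists of the other faces on the side of
  \<open>ys\<close>.\<close>

lemma loop_separates:
  assumes s: "simple (add_mset (a # ys @ b # zs) R)"
    and m: "matching (dset (add_mset (a # ys @ b # zs) R)) \<iota>" and ab: "\<iota> a = b"
    and c: "conn (add_mset (a # ys @ b # zs) R) \<iota>"
    and nc: "\<not> conn (add_mset ys (add_mset zs R)) (transpose a b \<circ> \<iota>)"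
  obtains G H where "R = G + H" "\<iota> ` dset (add_mset ys G) \<subseteq> dset (add_mset ys G)"
proof -
  let ?F = "a # ys @ b # zs" and ?M' = "add_mset ys (add_mset zs R)"
  have ba: "\<iota> b = a" using matching_simps[OF m] ab by metis
  have d: "dset ?M' = dset (add_mset ?F R) - {a, b}"
    using s by (auto simp: simple_add_mset)
  have s': "simple ?M'" using s by (auto simp: simple_add_mset)
  have m': "matching (dset ?M') (transpose a b \<circ> \<iota>)"
    unfolding d by (rule matching_cut[OF m _ ab]) auto
  have \<iota>': "(transpose a b \<circ> \<iota>) ` B = \<iota> ` B" if "B \<subseteq> dset ?M'" for B
  proof (rule image_cong[OF refl])
    fix x assume "x \<in> B"
    then have "x \<noteq> a" "x \<noteq> b" using that d by auto
    then have "\<iota> x \<noteq> a" "\<iota> x \<noteq> b" using matching_simps[OF m] ab ba by metis+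
    then show "(transpose a b \<circ> \<iota>) x = \<iota> x" by simp
  qed
  obtain G H where GH: "add_mset zs R = G + H" "H \<noteq> {#}"
    and cl': "(transpose a b \<circ> \<iota>) ` dset (add_mset ys G) \<subseteq> dset (add_mset ys G)"
    using nc unfolding conn_add_mset[OF s' m'] by blast
  have "dset (add_mset ys G) \<subseteq> dset ?M'" unfolding GH by auto
  then have cl: "\<iota> ` dset (add_mset ys G) \<subseteq> dset (add_mset ys G)" using cl' \<iota>' by simp
  \<comment> \<open>With \<open>ys\<close> and \<open>zs\<close> on the same side, restoring
    \<open>a\<close> and \<open>b\<close> would give a closed proper part of the connected
    surface.\<close>
  have "zs \<in># H"
  proof (rule ccontr)
    assume "zs \<notin># H"
    then have "zs \<in># G" using GH by (metis union_iff union_single_eq_member)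
    then obtain G1 where G: "G = add_mset zs G1" by (meson multi_member_split)
    then have R: "R = G1 + H" using GH by simp
    have "dset (add_mset ?F G1) = {a, b} \<union> dset (add_mset ys G)" by (auto simp: G)
    then have "\<iota> ` dset (add_mset ?F G1) \<subseteq> dset (add_mset ?F G1)" using cl ab ba by auto
    then show False using c GH(2) R unfolding conn_add_mset[OF s m] by blast
  qed
  then obtain H1 where "H = add_mset zs H1" by (meson multi_member_split)
  then have "R = G + H1" using GH by simp
  then show ?thesis using that cl by blast
qed

text \<open>Because \<open>\<iota>\<close> joins \<open>a\<close> to \<open>b\<close>, a closed part
  contains both of the faces or neither. Treating them as one face therefore loses no
  splitting.\<close>

lemma conn_cut_bridge:
  assumes s: "simple (add_mset (a # ys) (add_mset (us @ b # vs) R))"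
    and m: "matching (dset (add_mset (a # ys) (add_mset (us @ b # vs) R))) \<iota>" and ab: "\<iota> a = b"
  shows "conn (add_mset (a # ys) (add_mset (us @ b # vs) R)) \<iota>
    \<longleftrightarrow> conn (add_mset (ys @ vs @ us) R) (transpose a b \<circ> \<iota>)"
proof -
  let ?A = "a # ys" and ?B = "us @ b # vs" and ?W = "ys @ vs @ us"
  let ?\<iota> = "transpose a b \<circ> \<iota>"
  have ba: "\<iota> b = a" using matching_simps[OF m] ab by metis
  have d: "dset (add_mset ?W R) = dset (add_mset ?A (add_mset ?B R)) - {a, b}"
    using s by (auto simp: simple_add_mset)
  have sW: "simple (add_mset ?W R)" using s by (auto simp: simple_add_mset)
  have mW: "matching (dset (add_mset ?W R)) ?\<iota>"
    unfolding d by (rule matching_cut[OF m _ ab]) auto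
  have \<iota>': "?\<iota> ` B = \<iota> ` B" if "B \<subseteq> dset (add_mset ?W R)" for B
  proof (rule image_cong[OF refl])
    fix x assume "x \<in> B"
    then have "x \<noteq> a" "x \<noteq> b" using that d by auto
    then have "\<iota> x \<noteq> a" "\<iota> x \<noteq> b" using matching_simps[OF m] ab ba by metis+
    then show "?\<iota> x = \<iota> x" by simp
  qed
  show ?thesis unfolding conn_add_mset[OF s m] conn_add_mset[OF sW mW]
  proof (intro iffI allI impI)
    fix G H
    assume *: "\<forall>G H. add_mset ?B R = G + H \<longrightarrow>
        \<iota> ` dset (add_mset ?A G) \<subseteq> dset (add_mset ?A G) \<longrightarrow> H = {#}"
      and R: "R = G + H" and cl: "?\<iota> ` dset (add_mset ?W G) \<subseteq> dset (add_mset ?W G)"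
    have "dset (add_mset ?W G) \<subseteq> dset (add_mset ?W R)" using R by auto
    then have "\<iota> ` dset (add_mset ?W G) \<subseteq> dset (add_mset ?W G)" using cl \<iota>' by simp
    moreover have "dset (add_mset ?A (add_mset ?B G)) = {a, b} \<union> dset (add_mset ?W G)" by auto
    ultimately have "\<iota> ` dset (add_mset ?A (add_mset ?B G)) \<subseteq> dset (add_mset ?A (add_mset ?B G))"
      using ab ba by auto
    then show "H = {#}" using *[rule_format, of "add_mset ?B G" H] R by simp
  next
    fix G H
    assume *: "\<forall>G H. R = G + H \<longrightarrow>
        ?\<iota> ` dset (add_mset ?W G) \<subseteq> dset (add_mset ?W G) \<longrightarrow> H = {#}"
      and R: "add_mset ?B R = G + H" and cl: "\<iota> ` dset (add_mset ?A G) \<subseteq> dset (add_mset ?A G)"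
    \<comment> \<open>Closedness puts \<open>b\<close>, the partner of \<open>a\<close>, among the
      darts of the part containing \<open>?A\<close>, so its face cannot lie in
      \<open>H\<close>.\<close>
    have "?B \<in># G"
    proof (rule ccontr)
      assume "?B \<notin># G"
      then have "?B \<in># H" using R by (metis union_iff union_single_eq_member)
      then have "b \<in> dset H" unfolding dset_iff by force
      moreover have "b \<in> dset (add_mset ?A G)" using cl ab by auto
      ultimately show False using s unfolding R
        by (auto simp: simple_add_mset simple_union)
    qed
    then obtain G1 where G: "G = add_mset ?B G1" by (meson multi_member_split)
    then have R1: "R = G1 + H" using R by simp
    have eq: "dset (add_mset ?W G1) = dset (add_mset ?A G) - {a, b}"
      using s by (auto simp: simple_add_mset simple_union R1 G)
    have "\<iota> ` dset (add_mset ?W G1) \<subseteq> dset (add_mset ?W G1)"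
    proof
      fix y assume "y \<in> \<iota> ` dset (add_mset ?W G1)"
      then obtain x where x: "x \<in> dset (add_mset ?A G)" "x \<noteq> a" "x \<noteq> b" "y = \<iota> x"
        unfolding eq by auto
      then have "y \<noteq> a" "y \<noteq> b" using matching_simps[OF m] ab ba by metis+
      then show "y \<in> dset (add_mset ?W G1)" unfolding eq using x cl by auto
    qed
    moreover have "dset (add_mset ?W G1) \<subseteq> dset (add_mset ?W R)" using R1 by auto
    ultimately show "H = {#}" using *[rule_format, OF R1] \<iota>' by simp
  qed
qed

section \<open>Euler's inequality and its equality case\<close>

lemma dset_mono: "K \<subseteq># M \<Longrightarrow> dset K \<subseteq> dset M"
  by (auto simp: subset_iff dset_iff dest: mset_subset_eqD)

text \<open>A union of faces that is closed under \<open>\<iota>\<close> is invariant under the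
  vertex permutation, so no vertex cycle meets both parts; empty faces are counted additively in any
  case.\<close>

lemma vertices_union:
  assumes s: "simple (G + H)" and m: "matching (dset (G + H)) \<iota>" and cl: "\<iota> ` dset G \<subseteq> dset G"
  shows "vertices (G + H) \<iota>
    = vertices G (perm_restrict \<iota> (dset G)) + vertices H (perm_restrict \<iota> (dset H))"
proof -
  have sG: "simple G" and sH: "simple H" and disj: "dset G \<inter> dset H = {}"
    using s by (auto simp: simple_union)
  have clH: "\<iota> ` dset H \<subseteq> dset H"
    by (rule matching_complement_closed[OF m, of "dset G"]) (use disj cl in auto)
  have p: "face_map (G + H) \<circ> \<iota> permutes dset G \<union> dset H"
    using permutes_compose[OF matching_permutes[OF m] face_map_permutes[OF s]] by simp
  have part: "cycle_count (dset K) (face_map (G + H) \<circ> \<iota>)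
      = cycle_count (dset K) (face_map K \<circ> perm_restrict \<iota> (dset K))"
    if K: "simple K" "K \<subseteq># G + H" "\<iota> ` dset K \<subseteq> dset K" for K
  proof (rule cycle_count_cong[symmetric])
    have "dset K \<subseteq> dset (G + H)" using K(2) by (rule dset_mono)
    then have "perm_restrict \<iota> (dset K) permutes dset K"
      using matching_permutes[OF matching_restrict[OF m]] K by blast
    then show "face_map K \<circ> perm_restrict \<iota> (dset K) permutes dset K"
      using face_map_permutes[OF K(1)] by (rule permutes_compose)
    fix x assume x: "x \<in> dset K"
    then have "\<iota> x \<in> dset K" using K(3) by auto
    then obtain xs where xs: "xs \<in># K" "\<iota> x \<in> set xs" by (auto simp: dset_iff)
    then have "xs \<in># G + H" using K(2) by (meson mset_subset_eqD)
    then show "(face_map K \<circ> perm_restrict \<iota> (dset K)) x = (face_map (G + H) \<circ> \<iota>) x"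
      using face_map_in[OF K(1) xs] face_map_in[OF s _ xs(2)] x by (simp add: perm_restrict_def)
  qed simp

  have "(face_map (G + H) \<circ> \<iota>) ` dset G \<subseteq> dset G"
  proof
    fix y assume "y \<in> (face_map (G + H) \<circ> \<iota>) ` dset G"
    then obtain x where x: "x \<in> dset G" "y = face_map (G + H) (\<iota> x)" by auto
    then have "\<iota> x \<in> dset G" using cl by auto
    then obtain xs where xs: "xs \<in># G" "\<iota> x \<in> set xs" by (auto simp: dset_iff)
    then have "y = cycle_of_list xs (\<iota> x)" using x face_map_in[OF s _ xs(2)] by simp
    then have "y \<in> set xs" using xs(2) by (simp add: permutes_in_image[OF cycle_permutes])
    then show "y \<in> dset G" using xs(1) by (auto simp: dset_iff)
  qed
  then have "cycle_count (dset G \<union> dset H) (face_map (G + H) \<circ> \<iota>)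
    = cycle_count (dset G) (face_map (G + H) \<circ> \<iota>) + cycle_count (dset H) (face_map (G + H) \<circ> \<iota>)"
    using disj p by (intro cycle_count_disjoint_Un) auto
  then show ?thesis
    using part[OF sG _ cl] part[OF sH _ clH] by (simp add: vertices_def)
qed

lemma vertices_cut_loop_union:
  assumes s: "simple (add_mset (a # ys @ b # zs) (G + H))"
    and m: "matching (dset (add_mset (a # ys @ b # zs) (G + H))) \<iota>" and ab: "\<iota> a = b"
    and cl: "\<iota> ` dset (add_mset ys G) \<subseteq> dset (add_mset ys G)"
  shows "vertices (add_mset (a # ys @ b # zs) (G + H)) \<iota>
    = vertices (add_mset ys G) (perm_restrict \<iota> (dset (add_mset ys G)))
      + vertices (add_mset zs H) (perm_restrict \<iota> (dset (add_mset zs H)))"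
proof -
  let ?F = "a # ys @ b # zs" and ?Y = "add_mset ys G" and ?Z = "add_mset zs H"
  let ?\<iota> = "transpose a b \<circ> \<iota>"
  have ba: "\<iota> b = a" using matching_simps[OF m] ab by metis
  have s': "simple (?Y + ?Z)" using s by (auto simp: simple_add_mset simple_union)
  have d: "dset (?Y + ?Z) = dset (add_mset ?F (G + H)) - {a, b}"
    using s by (auto simp: simple_add_mset)
  have m': "matching (dset (?Y + ?Z)) ?\<iota>"
    unfolding d by (rule matching_cut[OF m _ ab]) auto
  have \<iota>': "?\<iota> x = \<iota> x" if "x \<in> dset ?Y \<union> dset ?Z" for x
  proof -
    have "x \<noteq> a" "x \<noteq> b" using that d by auto
    then have "\<iota> x \<noteq> a" "\<iota> x \<noteq> b" using matching_simps[OF m] ab ba by metis+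
    then show "?\<iota> x = \<iota> x" by simp
  qed
  have r: "perm_restrict ?\<iota> (dset ?Y) = perm_restrict \<iota> (dset ?Y)"
    "perm_restrict ?\<iota> (dset ?Z) = perm_restrict \<iota> (dset ?Z)"
    using \<iota>' by (auto simp: perm_restrict_def fun_eq_iff)
  have "?\<iota> ` dset ?Y = \<iota> ` dset ?Y" using \<iota>' by (intro image_cong) auto
  then have cl': "?\<iota> ` dset ?Y \<subseteq> dset ?Y" using cl by simp
  have "vertices (add_mset ?F (G + H)) \<iota> = vertices (?Y + ?Z) ?\<iota>"
    using vertices_cut_loop[OF s matching_permutes[OF m] ab ba] by (simp add: add_mset_commute)
  then show ?thesis using vertices_union[OF s' m' cl'] r by simp
qed

text \<open>This is F + V <= E + 2, doubled because there are 2 E darts. Removal of an edge keeps V.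
  A bridge between two faces lowers F and E by one each; a loop raises F by one and lowers E by one,
  and if it separates, the sum of the bounds for the two parts is exactly the bound for the
  whole.\<close>

lemma genus_nonneg:
  assumes "simple M" "matching (dset M) \<iota>" "conn M \<iota>"
  shows "2 * (size M + vertices M \<iota>) \<le> card (dset M) + 4"
  using assms
proof (induction "card (dset M)" arbitrary: M \<iota> rule: less_induct)
  case less
  note s = less.prems(1) and m = less.prems(2) and c = less.prems(3)
  show ?case
  proof (cases "dset M = {}")
    \<comment> \<open>Without darts every face is a component, so connectedness leaves a single
      empty face: F = V = 1 and E = 0, with equality.\<close>
    case True
    obtain F M' where M: "M = add_mset F M'" using c by (metis conn_def multiset_cases)
    have "\<iota> ` dset {#F#} \<subseteq> dset {#F#}" "M = {#F#} + M'" "F = []" using True M by auto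
    then have "M' = {#}" using c unfolding conn_def by (metis add_mset_not_empty)
    then have "M = {#[]#}" using M \<open>F = []\<close> by simp
    then show ?thesis by (simp add: vertices_def cycle_count_def)
  next
    case False
    then obtain F where F: "F \<in># M" "F \<noteq> []" by (metis all_not_in_conv dset_iff empty_iff empty_set)
    then obtain a xs where Fa: "F = a # xs" by (meson neq_Nil_conv)
    obtain M1 where M1: "M = add_mset (a # xs) M1" using F Fa by (metis multi_member_split)
    define b where "b = \<iota> a"
    have ab: "\<iota> a = b" "\<iota> b = a" and "b \<noteq> a" and bM: "b \<in> dset M"
      using matching_simps[OF m, of a] M1 by (auto simp: b_def)
    have card2: "card (dset M - {a, b}) + 2 = card (dset M)"
    proof -
      have "{a, b} \<subseteq> dset M" using bM M1 by auto
      then have "card (dset M - {a, b}) = card (dset M) - 2" "2 \<le> card (dset M)"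
        using \<open>b \<noteq> a\<close> card_mono[of "dset M" "{a, b}"] by (auto simp: card_Diff_subset)
      then show ?thesis by simp
    qed
    show ?thesis
    proof (cases "b \<in> set xs")
      case True
      then obtain ys zs where "xs = ys @ b # zs" by (meson split_list)
      then have M: "M = add_mset (a # ys @ b # zs) M1" using M1 by simp
      let ?M' = "add_mset ys (add_mset zs M1)" and ?\<iota> = "transpose a b \<circ> \<iota>"
      have d': "dset ?M' = dset M - {a, b}" using s by (auto simp: M simple_add_mset)
      have s': "simple ?M'" using s by (auto simp: M simple_add_mset)
      show ?thesis
      proof (cases "conn ?M' ?\<iota>")
        case True
        have m': "matching (dset ?M') ?\<iota>" unfolding d' by (rule matching_cut[OF m _ ab(1)]) (auto simp: M)
        \<comment> \<open>One face more and two darts fewer: in this case the bound for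
          \<open>M\<close> holds with 4 to spare.\<close>
        have "2 * (size ?M' + vertices ?M' ?\<iota>) \<le> card (dset ?M') + 4"
          using less.hyps[OF _ s' m' True] card2 d' by simp
        moreover have "vertices M \<iota> = vertices ?M' ?\<iota>"
          using vertices_cut_loop[of a ys b zs M1 \<iota>] s m ab unfolding M by (blast intro: matching_permutes)
        ultimately show ?thesis using card2 d' by (simp add: M)
      next
        case False
        obtain G H where GH: "M1 = G + H" and cl: "\<iota> ` dset (add_mset ys G) \<subseteq> dset (add_mset ys G)"
          using loop_separates[OF s[unfolded M] m[unfolded M] ab(1) c[unfolded M] False] .
        note sM = s[unfolded M GH] and mM = m[unfolded M GH]
        let ?Y = "add_mset ys G" and ?Z = "add_mset zs H"
        note cz = conn_cut_loop[OF sM mM ab(1) cl]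
        have cYZ: "conn ?Y (perm_restrict \<iota> (dset ?Y))" "conn ?Z (perm_restrict \<iota> (dset ?Z))"
          using cz(2) c unfolding M GH by auto
        have sYZ: "simple ?Y" "simple ?Z" and dYZ: "dset ?Y \<inter> dset ?Z = {}"
          "dset ?Y \<union> dset ?Z = dset M - {a, b}"
          using sM by (auto simp: simple_add_mset simple_union M GH)
        have mYZ: "matching (dset ?Y) (perm_restrict \<iota> (dset ?Y))"
          "matching (dset ?Z) (perm_restrict \<iota> (dset ?Z))"
          by (rule matching_restrict[OF m _ cl], use dYZ in force)
            (rule matching_restrict[OF m _ cz(1)], use dYZ in force)
        have cards: "card (dset ?Y) + card (dset ?Z) + 2 = card (dset M)"
          using card_Un_disjoint[OF _ _ dYZ(1)] dYZ(2) card2 by simp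
        have "2 * (size ?Y + vertices ?Y (perm_restrict \<iota> (dset ?Y))) \<le> card (dset ?Y) + 4"
          "2 * (size ?Z + vertices ?Z (perm_restrict \<iota> (dset ?Z))) \<le> card (dset ?Z) + 4"
          using cards less.hyps[OF _ sYZ(1) mYZ(1) cYZ(1)] less.hyps[OF _ sYZ(2) mYZ(2) cYZ(2)] by linarith+
        moreover have "vertices M \<iota> = vertices ?Y (perm_restrict \<iota> (dset ?Y))
            + vertices ?Z (perm_restrict \<iota> (dset ?Z))"
          using vertices_cut_loop_union[OF sM mM ab(1) cl] unfolding M GH .
        ultimately show ?thesis using cards by (simp add: M GH)
      qed
    next
      case False
      then have "b \<in> dset M1" using bM \<open>b \<noteq> a\<close> by (simp add: M1)
      then obtain F' where F': "F' \<in># M1" "b \<in> set F'" by (auto simp: dset_iff)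
      then obtain us vs where uv: "F' = us @ b # vs" by (meson split_list)
      then obtain R where M: "M = add_mset (a # xs) (add_mset (us @ b # vs) R)"
        using F' M1 by (metis multi_member_split)
      let ?M' = "add_mset (xs @ vs @ us) R" and ?\<iota> = "transpose a b \<circ> \<iota>"
      have d': "dset ?M' = dset M - {a, b}" using s by (auto simp: M simple_add_mset)
      have s': "simple ?M'" using s by (auto simp: M simple_add_mset)
      have m': "matching (dset ?M') ?\<iota>" unfolding d' by (rule matching_cut[OF m _ ab(1)]) (auto simp: M)
      have c': "conn ?M' ?\<iota>" using conn_cut_bridge[OF s[unfolded M] m[unfolded M] ab(1)] c unfolding M by simp
      have "2 * (size ?M' + vertices ?M' ?\<iota>) \<le> card (dset ?M') + 4"
        using less.hyps[OF _ s' m' c'] card2 d' by simp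
      moreover have "vertices M \<iota> = vertices ?M' ?\<iota>"
        using vertices_cut_bridge[of a xs us b vs R \<iota>] s m ab unfolding M by (blast intro: matching_permutes)
      ultimately show ?thesis using card2 d' by (simp add: M)
    qed
  qed
qed

text \<open>The last conjunct is Euler's formula F + V = E + 2 in terms of darts, that is, equality
  in \<open>genus_nonneg\<close>.\<close>

definition sphere :: "'a list multiset \<Rightarrow> ('a \<Rightarrow> 'a) \<Rightarrow> bool" where
  "sphere M \<iota> \<longleftrightarrow> simple M \<and> matching (dset M) \<iota> \<and> conn M \<iota>
     \<and> 2 * (size M + vertices M \<iota>) = card (dset M) + 4"

lemma card_dset_cut_loop:
  assumes "simple (add_mset (a # ys @ b # zs) (G + H))"
  shows "card (dset (add_mset (a # ys @ b # zs) (G + H)))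
    = card (dset (add_mset ys G)) + card (dset (add_mset zs H)) + 2"
proof -
  have "simple (add_mset ys G)" "simple (add_mset zs H)"
    using assms by (auto simp: simple_add_mset simple_union)
  then show ?thesis unfolding card_dset[OF assms] by (simp add: card_dset del: darts_simps) simp
qed

text \<open>The bounds for the two pieces add up exactly to the bound for the whole, so it is
  attained if and only if both of them are.\<close>

lemma euler_sum:
  fixes n v c n1 v1 c1 n2 v2 c2 :: nat
  assumes "n + 1 = n1 + n2" "v = v1 + v2" "c = c1 + c2 + 2"
    "2 * (n1 + v1) \<le> c1 + 4" "2 * (n2 + v2) \<le> c2 + 4"
  shows "2 * (n + v) = c + 4 \<longleftrightarrow> 2 * (n1 + v1) = c1 + 4 \<and> 2 * (n2 + v2) = c2 + 4"
  using assms by auto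

lemma sphere_cut_loop:
  assumes s: "simple (add_mset (a # ys @ b # zs) (G + H))"
    and m: "matching (dset (add_mset (a # ys @ b # zs) (G + H))) \<iota>" and ab: "\<iota> a = b"
    and cl: "\<iota> ` dset (add_mset ys G) \<subseteq> dset (add_mset ys G)"
  shows "sphere (add_mset (a # ys @ b # zs) (G + H)) \<iota>
      \<longleftrightarrow> sphere (add_mset ys G) (perm_restrict \<iota> (dset (add_mset ys G)))
        \<and> sphere (add_mset zs H) (perm_restrict \<iota> (dset (add_mset zs H)))"
proof -
  let ?Y = "add_mset ys G" and ?Z = "add_mset zs H" and ?S = "add_mset (a # ys @ b # zs) (G + H)"
  note cz = conn_cut_loop[OF s m ab cl]
  have sYZ: "simple ?Y" "simple ?Z" using s by (auto simp: simple_add_mset simple_union)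
  have mYZ: "matching (dset ?Y) (perm_restrict \<iota> (dset ?Y))"
    "matching (dset ?Z) (perm_restrict \<iota> (dset ?Z))"
    by (rule matching_restrict[OF m _ cl], force) (rule matching_restrict[OF m _ cz(1)], force)
  have size: "size ?S + 1 = size ?Y + size ?Z" by simp
  note v = vertices_cut_loop_union[OF s m ab cl] and c = card_dset_cut_loop[OF s]
  show ?thesis
  proof (cases "conn ?S \<iota>")
    case True
    then have *: "conn ?Y (perm_restrict \<iota> (dset ?Y))" "conn ?Z (perm_restrict \<iota> (dset ?Z))"
      using cz(2) by auto
    note ineqs = size v c genus_nonneg[OF sYZ(1) mYZ(1) *(1)] genus_nonneg[OF sYZ(2) mYZ(2) *(2)]
    have "2 * (size ?S + vertices ?S \<iota>) = card (dset ?S) + 4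
      \<longleftrightarrow> 2 * (size ?Y + vertices ?Y (perm_restrict \<iota> (dset ?Y))) = card (dset ?Y) + 4
        \<and> 2 * (size ?Z + vertices ?Z (perm_restrict \<iota> (dset ?Z))) = card (dset ?Z) + 4"
      by (rule euler_sum) (fact ineqs)+
    then show ?thesis
      unfolding sphere_def by (simp only: True * s m sYZ mYZ simp_thms)
  next
    case False
    then show ?thesis unfolding sphere_def cz(2) by (simp only: simp_thms de_Morgan_conj) blast
  qed
qed

text \<open>If the cut surface were connected, it would have one face more, one edge fewer and the
  same number of vertices as a sphere. Then F + V - E = 4, which contradicts
  \<open>genus_nonneg\<close>.\<close>

lemma sphere_loop_separates:
  assumes sp: "sphere (add_mset (a # ys @ b # zs) R) \<iota>" and ab: "\<iota> a = b"
  obtains G H where "R = G + H" "\<iota> ` dset (add_mset ys G) \<subseteq> dset (add_mset ys G)"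
proof -
  let ?S = "add_mset (a # ys @ b # zs) R"
  let ?M' = "add_mset ys (add_mset zs R)" and ?\<iota> = "transpose a b \<circ> \<iota>"
  have s: "simple ?S" and m: "matching (dset ?S) \<iota>" and c: "conn ?S \<iota>"
    and g: "2 * (size ?S + vertices ?S \<iota>) = card (dset ?S) + 4"
    using sp by (auto simp: sphere_def)
  have ba: "\<iota> b = a" using matching_simps[OF m] ab by metis
  have s': "simple ?M'" using s by (auto simp: simple_add_mset)
  have d': "dset ?M' = dset ?S - {a, b}" using s by (auto simp: simple_add_mset)
  have m': "matching (dset ?M') ?\<iota>" unfolding d' by (rule matching_cut[OF m _ ab]) auto
  have "\<not> conn ?M' ?\<iota>"
  proof
    assume "conn ?M' ?\<iota>"
    from genus_nonneg[OF s' m' this] g card_dset[OF s] card_dset[OF s']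
      vertices_cut_loop[OF s matching_permutes[OF m] ab ba]
    show False by simp
  qed
  from loop_separates[OF s m ab c this] that show ?thesis by blast
qed

text \<open>The numbers of faces and edges both drop by one and the number of vertices is kept, so
  Euler's formula is equivalent before and after.\<close>

lemma sphere_cut_bridge:
  assumes s: "simple (add_mset (a # ys) (add_mset (us @ b # vs) R))"
    and m: "matching (dset (add_mset (a # ys) (add_mset (us @ b # vs) R))) \<iota>" and ab: "\<iota> a = b"
  shows "sphere (add_mset (a # ys) (add_mset (us @ b # vs) R)) \<iota>
    \<longleftrightarrow> sphere (add_mset (ys @ vs @ us) R) (transpose a b \<circ> \<iota>)"
proof -
  let ?S = "add_mset (a # ys) (add_mset (us @ b # vs) R)"
  let ?M' = "add_mset (ys @ vs @ us) R"
  have ba: "\<iota> b = a" using matching_simps[OF m] ab by metis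
  have s': "simple ?M'" using s by (auto simp: simple_add_mset)
  have d': "dset ?M' = dset ?S - {a, b}" using s by (auto simp: simple_add_mset)
  have m': "matching (dset ?M') (transpose a b \<circ> \<iota>)"
    unfolding d' by (rule matching_cut[OF m _ ab]) auto
  have "size ?S = size ?M' + 1" by simp
  moreover have "card (dset ?S) = card (dset ?M') + 2"
    unfolding card_dset[OF s] card_dset[OF s'] by simp
  ultimately have "2 * (size ?S + vertices ?S \<iota>) = card (dset ?S) + 4
      \<longleftrightarrow> 2 * (size ?M' + vertices ?M' (transpose a b \<circ> \<iota>)) = card (dset ?M') + 4"
    using vertices_cut_bridge[OF s matching_permutes[OF m] ab ba] by (simp only:) (rule iffI; simp)
  then show ?thesis
    unfolding sphere_def by (simp only: s m s' m' conn_cut_bridge[OF s m ab] simp_thms)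
qed

section \<open>Labelled gluings\<close>

lemma cycle_of_list_map:
  assumes "inj g"
  shows "cycle_of_list (map g xs) (g x) = g (cycle_of_list xs x)"
proof (induction xs rule: cycle_of_list.induct)
  case (1 i j cs)
  have "transpose (g i) (g j) (g y) = g (transpose i j y)" for y
    using assms by (auto simp: transpose_def inj_eq)
  then show ?case using 1 by simp
qed simp_all

lemma darts_image: "darts (image_mset (map g) M) = image_mset g (darts M)"
  by (induction M) auto

lemma dset_image: "dset (image_mset (map g) M) = g ` dset M"
  by (simp add: darts_image)

lemma simple_image: "inj g \<Longrightarrow> simple M \<Longrightarrow> simple (image_mset (map g) M)"
  by (induction M) (auto simp: simple_add_mset dset_image distinct_map inj_eq dest: inj_on_subset)

lemma face_map_image:
  assumes g: "inj g" and s: "simple M"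
  shows "face_map (image_mset (map g) M) (g x) = g (face_map M x)"
proof (cases "x \<in> dset M")
  case True
  then obtain xs where xs: "xs \<in># M" "x \<in> set xs" by (auto simp: dset_iff)
  then have "map g xs \<in># image_mset (map g) M" "g x \<in> set (map g xs)" by auto
  from face_map_in[OF simple_image[OF g s] this] face_map_in[OF s xs]
  show ?thesis using cycle_of_list_map[OF g] by simp
next
  case False
  then have "g x \<notin> dset (image_mset (map g) M)"
    using g by (auto simp: dset_image inj_eq)
  then show ?thesis using False by (simp add: face_map_def)
qed

lemma vertices_image:
  assumes g: "inj g" and s: "simple M" and \<kappa>: "\<And>x. \<kappa> (g x) = g (\<iota> x)"
  shows "vertices (image_mset (map g) M) \<kappa> = vertices M \<iota>"
proof -
  have "count (image_mset (map g) M) [] = count M []"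
    by (induction M) auto
  moreover have "cycle_count (g ` dset M) (face_map (image_mset (map g) M) \<circ> \<kappa>)
      = cycle_count (dset M) (face_map M \<circ> \<iota>)"
    using face_map_image[OF g s] \<kappa> by (intro cycle_count_image[OF g]) simp
  ultimately show ?thesis by (simp add: vertices_def dset_image)
qed

lemma conn_image:
  assumes g: "inj g" and \<kappa>: "\<And>x. \<kappa> (g x) = g (\<iota> x)" and c: "conn M \<iota>"
  shows "conn (image_mset (map g) M) \<kappa>"
  unfolding conn_def
proof (intro conjI allI impI)
  show "image_mset (map g) M \<noteq> {#}" using c by (simp add: conn_def)
  fix G H
  assume "image_mset (map g) M = G + H" and cl: "\<kappa> ` dset G \<subseteq> dset G"
  then obtain G' H' where GH: "M = G' + H'" "G = image_mset (map g) G'" "H = image_mset (map g) H'"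
    by (metis image_mset_eq_plusD)
  have "\<iota> ` dset G' \<subseteq> dset G'"
    using cl g unfolding GH dset_image by (auto simp: \<kappa> inj_eq image_subset_iff)
  then show "G = {#} \<or> H = {#}" using c GH unfolding conn_def by auto
qed

text \<open>The renaming is a bijection of the whole type because \<open>matching\<close> also
  constrains the points that are not labels.\<close>

lemma sphere_image:
  assumes g: "bij g" and \<kappa>: "\<And>x. \<kappa> (g x) = g (\<iota> x)" and sp: "sphere M \<iota>"
  shows "sphere (image_mset (map g) M) \<kappa>"
proof -
  have i: "inj g" and s: "simple M" and m: "matching (dset M) \<iota>"
    using g sp by (auto simp: bij_is_inj sphere_def)
  have "matching (g ` dset M) \<kappa>"
    unfolding matching_def
  proof (intro conjI allI)
    fix y
    obtain x where y: "y = g x" using g by (metis bij_pointE)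
    show "\<kappa> (\<kappa> y) = y" "\<kappa> y = y \<longleftrightarrow> y \<notin> g ` dset M"
      using matching_simps[OF m] i by (auto simp: y \<kappa> inj_eq)
  qed
  moreover have "card (g ` dset M) = card (dset M)"
    using i by (meson card_image inj_on_subset subset_UNIV)
  moreover have "conn (image_mset (map g) M) \<kappa>"
    using sp by (intro conn_image[OF i, of \<kappa> \<iota>]) (simp_all add: \<kappa> sphere_def)
  moreover have "vertices (image_mset (map g) M) \<kappa> = vertices M \<iota>"
    by (intro vertices_image[OF i s]) (simp add: \<kappa>)
  ultimately show ?thesis
    using sp simple_image[OF i s] by (simp add: sphere_def dset_image)
qed

text \<open>An empty face is closed by itself, so in a connected gluing it is the only face.\<close>

lemma sphere_nonempty_faces:
  assumes sp: "sphere M \<iota>" and ne: "dset M \<noteq> {}"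
  shows "[] \<notin># M"
proof
  assume "[] \<in># M"
  then obtain M' where M: "M = {#[]#} + M'" by (metis add_mset_add_single multi_member_split union_commute)
  have "\<iota> ` dset {#[]#} \<subseteq> dset {#[]#}" by simp
  then have "M' = {#}" using sp M unfolding sphere_def conn_def by (metis add_mset_not_empty)
  then show False using ne M by simp
qed

section \<open>Gluing data as gluings with the standard labels\<close>

lemma foldr_cycle_of_list:
  "distinct (concat Fs) \<Longrightarrow> foldr (\<circ>) (map cycle_of_list Fs) id = face_map (mset Fs)"
proof (induction Fs)
  case (Cons F Fs)
  then have "simple (add_mset F (mset Fs))" using simple_mset[of "F # Fs"] by simp
  from face_map_add_mset[OF this] Cons show ?case by simp
qed simp

definition intervals :: "nat list \<Rightarrow> nat list list" where
  "intervals ms = map (\<lambda>i. [psum ms i + 1 ..< psum ms (i + 1) + 1]) [0..<length ms]"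

lemma intervals_snoc:
  "intervals (ms @ [m]) = intervals ms @ [[sum_list ms + 1 ..< sum_list ms + m + 1]]"
  by (auto simp: intervals_def psum_def)

lemma concat_intervals: "concat (intervals ms) = [1..<sum_list ms + 1]"
proof (induction ms rule: rev_induct)
  case Nil
  then show ?case by (simp add: intervals_def)
next
  case (snoc m ms)
  then show ?case
    using upt_add_eq_append[of 1 "sum_list ms + 1" m] by (simp add: intervals_snoc del: upt_Suc)
qed

lemma map_length_intervals: "map length (intervals ms) = ms"
proof (induction ms rule: rev_induct)
  case Nil
  then show ?case by (simp add: intervals_def)
next
  case (snoc m ms)
  then show ?case by (simp add: intervals_snoc del: upt_Suc)
qed

text \<open>A labelled list of faces is thus the same as a word of labels together with the
  composition of face lengths; the count of labellings rests on this.\<close>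

lemma concat_map_length_eqI:
  "concat Fs = concat Gs \<Longrightarrow> map length Fs = map length Gs \<Longrightarrow> Fs = Gs"
proof (induction Fs arbitrary: Gs)
  case (Cons F Fs)
  then show ?case by (cases Gs) auto
qed auto

lemma face_perm_eq: "face_perm ms = face_map (mset (intervals ms))"
proof -
  have "distinct (concat (intervals ms))" unfolding concat_intervals by simp
  from foldr_cycle_of_list[OF this] show ?thesis
    unfolding face_perm_def intervals_def by (simp only: map_map comp_def)
qed

lemma fpf_involution_iff_matching: "fpf_involution \<iota> n \<longleftrightarrow> matching {1..n} \<iota>"
proof
  assume "fpf_involution \<iota> n"
  then show "matching {1..n} \<iota>"
    unfolding fpf_involution_def matching_def by (metis permutes_not_in)
next
  assume m: "matching {1..n} \<iota>"
  then show "fpf_involution \<iota> n"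
    using matching_permutes[OF m] matching_simps[OF m] by (simp add: fpf_involution_def)
qed

lemma face_map_closed_subset:
  assumes s: "simple M" and F: "F \<in># M" and x: "x \<in> set F" "x \<in> X"
    and cl: "\<And>y. y \<in> X \<Longrightarrow> face_map M y \<in> X"
  shows "set F \<subseteq> X"
proof
  fix z assume "z \<in> set F"
  obtain i where i: "i < length F" "x = F ! i" using x by (metis in_set_conv_nth)
  obtain j where j: "j < length F" "z = F ! j" using \<open>z \<in> set F\<close> by (metis in_set_conv_nth)
  have dF: "distinct F" using s F by (metis multi_member_split simple_add_mset)
  \<comment> \<open>\<open>k + i\<close> is \<open>j\<close> plus one full turn, so the
    \<open>k\<close>-th power of the cycle sends position \<open>i\<close> to position
    \<open>j\<close>; the full turn keeps the exponent a natural number.\<close>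
  define k where "k = j + (length F - i)"
  have "map (cycle_of_list F ^^ k) F ! i = rotate k F ! i"
    by (simp add: cyclic_rotation[OF dF])
  then have "(cycle_of_list F ^^ k) x = F ! ((k + i) mod length F)"
    using i by (simp add: nth_rotate)
  also have "(k + i) mod length F = j" using i j by (simp add: k_def)
  finally have z: "(cycle_of_list F ^^ k) x = z" using j by simp
  have "(cycle_of_list F ^^ n) x \<in> X \<inter> set F" for n
  proof (induction n)
    case (Suc n)
    then show ?case
      using cl[of "(cycle_of_list F ^^ n) x"] face_map_in[OF s F, of "(cycle_of_list F ^^ n) x"]
      by (simp add: permutes_in_image[OF cycle_permutes])
  qed (use x in simp)
  then show "z \<in> X" using z by blast
qed

text \<open>A union of faces closed under \<open>\<iota>\<close> is invariant under the whole group,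
  and conversely an orbit of the group is such a union. The group action cannot see empty faces,
  whereas \<open>conn\<close> treats each as a component; hence
  \<open>[] \<notin># M\<close>.\<close>

lemma transitive_iff_conn:
  assumes s: "simple M" and d: "dset M = {1..n}" and n: "n \<ge> 1" and m: "matching {1..n} \<iota>"
    and ne: "[] \<notin># M"
  shows "(\<forall>x\<in>{1..n}. \<forall>y\<in>{1..n}. \<exists>p\<in>generate (sym_group n) {\<iota>, face_map M}. p x = y)
    \<longleftrightarrow> conn M \<iota>"
proof -
  let ?gen = "generate (sym_group n) {\<iota>, face_map M}"
  have \<iota>: "\<iota> permutes {1..n}" by (rule matching_permutes[OF m])
  have \<sigma>: "face_map M permutes {1..n}" using face_map_permutes[OF s] d by simp
  have gen: "p permutes {1..n}" if "p \<in> ?gen" for p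
    using group.generate_incl[OF sym_group_is_group, of "{\<iota>, face_map M}" n] that \<iota> \<sigma>
    by (auto simp: sym_group_carrier)
  show ?thesis
  proof
    assume tr: "\<forall>x\<in>{1..n}. \<forall>y\<in>{1..n}. \<exists>p\<in>?gen. p x = y"
    show "conn M \<iota>" unfolding conn_def
    proof (intro conjI allI impI)
      show "M \<noteq> {#}" using d n by auto
      fix G H assume M: "M = G + H" and cl: "\<iota> ` dset G \<subseteq> dset G"
      show "G = {#} \<or> H = {#}"
      proof (rule ccontr)
        assume "\<not> (G = {#} \<or> H = {#})"
        then obtain F F' where F: "F \<in># G" "F' \<in># H" by (metis multiset_nonemptyE)
        then have "F \<noteq> []" "F' \<noteq> []" using ne M by auto
        then obtain x y where "x \<in> set F" "y \<in> set F'" by (meson list.set_sel(1))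
        with F have x: "x \<in> dset G" and y: "y \<in> dset H" by (auto simp: dset_iff)
        have disj: "dset G \<inter> dset H = {}" using s M by (simp add: simple_union)
        have sub: "dset G \<subseteq> {1..n}" "dset H \<subseteq> {1..n}" using d M by auto
        have cl\<sigma>: "face_map M ` dset G \<subseteq> dset G"
        proof
          fix w assume "w \<in> face_map M ` dset G"
          then obtain v xs where v: "w = face_map M v" "xs \<in># G" "v \<in> set xs" by (auto simp: dset_iff)
          then have "w = cycle_of_list xs v" using face_map_in[OF s, of xs v] M by simp
          then have "w \<in> set xs" using v by (simp add: permutes_in_image[OF cycle_permutes])
          then show "w \<in> dset G" using v by (auto simp: dset_iff)
        qed
        \<comment> \<open>Equality, which finiteness provides, passes to the inverses of the
          generators.\<close>
        have base: "p ` dset G = dset G" if "p \<in> {\<iota>, face_map M}" for p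
        proof -
          have "inj p" using that \<iota> \<sigma> by (auto dest: permutes_inj)
          moreover have "p ` dset G \<subseteq> dset G" using that cl cl\<sigma> by auto
          ultimately show ?thesis by (meson endo_inj_surj finite_set_mset inj_on_subset subset_UNIV)
        qed
        have "p ` dset G = dset G" if "p \<in> ?gen" for p
          using that
        proof induction
          case one
          then show ?case by (simp add: sym_group_one)
        next
          case (incl p)
          then show ?case by (rule base)
        next
          case (inv p)
          then have p: "p permutes {1..n}" using \<iota> \<sigma> by auto
          have "inv' p ` dset G = inv' p ` p ` dset G" using base[OF inv] by simp
          also have "\<dots> = dset G" using permutes_inj[OF p] by (simp add: image_image)
          finally show ?case using p by (simp add: sym_group_carrier)
        next
          case (eng p q)
          then show ?case by (simp only: sym_group_mult image_comp[symmetric])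
        qed
        moreover obtain p where "p \<in> ?gen" "p x = y" using tr x y sub by blast
        ultimately have "y \<in> dset G" using x by blast
        then show False using y disj by auto
      qed
    qed
  next
    assume c: "conn M \<iota>"
    show "\<forall>x\<in>{1..n}. \<forall>y\<in>{1..n}. \<exists>p\<in>?gen. p x = y"
    proof (intro ballI)
      fix x y assume x: "x \<in> {1..n}" and y: "y \<in> {1..n}"
      define X where "X = {p x | p. p \<in> ?gen}"
      have "id \<in> ?gen" using generate.one[of "sym_group n" "{\<iota>, face_map M}"]
        by (simp add: sym_group_one)
      then have xX: "x \<in> X" unfolding X_def by (intro CollectI exI[of _ id]) simp
      have Xcl: "q z \<in> X" if "z \<in> X" "q \<in> {\<iota>, face_map M}" for q z
      proof -
        obtain p where "z = p x" "p \<in> ?gen" using \<open>z \<in> X\<close> by (auto simp: X_def)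
        moreover have "q \<circ> p \<in> ?gen"
          using generate.eng[OF generate.incl[OF that(2)] \<open>p \<in> ?gen\<close>] by (simp add: sym_group_mult)
        ultimately show ?thesis unfolding X_def by (intro CollectI exI[of _ "q \<circ> p"]) simp
      qed
      have XA: "X \<subseteq> {1..n}"
      proof
        fix z assume "z \<in> X"
        then obtain p where p: "z = p x" "p \<in> ?gen" unfolding X_def by blast
        show "z \<in> {1..n}" unfolding p(1) permutes_in_image[OF gen[OF p(2)]] by (rule x)
      qed
      \<comment> \<open>Closure of the orbit \<open>X\<close> under the face permutation means that
        a face meeting \<open>X\<close> lies inside it, so the darts of \<open>G\<close> form
        exactly \<open>X\<close>.\<close>
      define G H where "G = {#F \<in># M. set F \<inter> X \<noteq> {}#}" and "H = {#F \<in># M. \<not> set F \<inter> X \<noteq> {}#}"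
      have M: "M = G + H" unfolding G_def H_def by (rule multiset_partition)
      have sub: "set F \<subseteq> X" if "F \<in># G" for F
        using that face_map_closed_subset[OF s, of F _ X] Xcl by (auto simp: G_def)
      have dG: "dset G = X"
      proof
        show "dset G \<subseteq> X"
        proof
          fix z assume "z \<in> dset G"
          then obtain F where "F \<in># G" "z \<in> set F" unfolding dset_iff by blast
          then show "z \<in> X" using sub by blast
        qed
        show "X \<subseteq> dset G"
        proof
          fix z assume z: "z \<in> X"
          then obtain F where "F \<in># M" "z \<in> set F" using XA d by (metis dset_iff subset_iff)
          with z show "z \<in> dset G" by (auto simp: dset_iff G_def)
        qed
      qed
      have "\<iota> ` dset G \<subseteq> dset G" unfolding dG using Xcl by auto
      moreover have "G \<noteq> {#}" using dG xX by auto
      ultimately have "H = {#}" using c M unfolding conn_def by blast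
      then have "X = {1..n}" using dG d M by simp
      then have "y \<in> X" using y by simp
      then show "\<exists>p\<in>?gen. p x = y" unfolding X_def by blast
    qed
  qed
qed

text \<open>With N edges, K faces and g = 0 the cycle count N - K + 2 is Euler's formula. Positivity
  of the parts is recovered on the right from \<open>sphere_nonempty_faces\<close>.\<close>

lemma connected_data_iff_sphere:
  assumes N: "N \<ge> 1" and K: "K \<ge> 1"
  shows "(ms, \<iota>) \<in> connected_data 0 N K \<longleftrightarrow>
    length ms = K \<and> sum_list ms = 2 * N \<and> sphere (mset (intervals ms)) \<iota>"
proof (cases "length ms = K \<and> sum_list ms = 2 * N")
  case True
  let ?M = "mset (intervals ms)"
  have s: "simple ?M" unfolding simple_mset concat_intervals by simp
  have d: "dset ?M = {1..2 * N}" unfolding dset_mset concat_intervals using True by (auto simp del: upt_Suc)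
  have ne: "[] \<notin># ?M \<longleftrightarrow> composition ms (2 * N)"
  proof -
    have "set ms = length ` set (intervals ms)" by (metis map_length_intervals set_map)
    then show ?thesis unfolding composition_def using True by auto
  qed
  have size: "size ?M = K" using True by (simp add: intervals_def)
  have g: "has_genus 0 N K (ms, \<iota>) \<longleftrightarrow> 2 * (size ?M + vertices ?M \<iota>) = card (dset ?M) + 4"
    if "[] \<notin># ?M"
  proof -
    have "count ?M [] = 0" using that by (simp only: count_eq_zero_iff not_False_eq_True)
    then have "vertices ?M \<iota> = num_cycles (2 * N) (face_perm ms \<circ> \<iota>)"
      unfolding vertices_def num_cycles_def cycle_count_def face_perm_eq d by simp
    then show ?thesis unfolding has_genus_def size d by auto
  qed
  show ?thesis
  proof (cases "composition ms (2 * N)")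
    case comp: True
    then have ne': "[] \<notin># ?M" using ne by simp
    show ?thesis
    proof (cases "matching {1..2 * N} \<iota>")
      case m: True
      show ?thesis
        using transitive_iff_conn[OF s d _ m ne'] g[OF ne'] True comp N K m s d
        unfolding connected_data_def gluing_datum_def sphere_def connected_datum_def
          fpf_involution_iff_matching face_perm_eq by simp
    next
      case False
      then show ?thesis
        unfolding connected_data_def gluing_datum_def sphere_def d fpf_involution_iff_matching by simp
    qed
  next
    case False
    moreover have "\<not> sphere ?M \<iota>"
      using sphere_nonempty_faces[of ?M \<iota>] False ne d N by auto
    ultimately show ?thesis
      unfolding connected_data_def gluing_datum_def by simp
  qed
next
  case False
  then show ?thesis unfolding connected_data_def gluing_datum_def composition_def by auto
qed

section \<open>Counting labelled spheres\<close>

lemma bij_extension: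
  fixes f :: "'a \<Rightarrow> 'a"
  assumes f: "bij_betw f A B" and fin: "finite A"
  obtains g where "bij g" "\<And>x. x \<in> A \<Longrightarrow> g x = f x"
proof -
  have finB: "finite B" and card: "card A = card B"
    using f fin bij_betw_finite bij_betw_same_card by blast+
  \<comment> \<open>Sending \<open>B - A\<close> back to \<open>A - B\<close> and fixing everything
    outside the union completes \<open>f\<close> to a bijection of the whole type, as
    \<open>sphere_image\<close> requires.\<close>
  have "card (B - A) = card (A - B)"
    using card fin finB by (metis card_Diff_subset_Int card_Int_Diff diff_add_inverse finite_Int inf_commute)
  then obtain h where h: "bij_betw h (B - A) (A - B)"
    using fin finB by (metis finite_Diff finite_same_card_bij)
  let ?g = "\<lambda>x. if x \<in> A then f x else if x \<in> B - A then h x else x"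
  have g1: "bij_betw ?g A B" using f by (subst bij_betw_cong[where g = f]) auto
  have g2: "bij_betw ?g (B - A) (A - B)" using h by (subst bij_betw_cong[where g = h]) auto
  have g3: "bij_betw ?g (- (A \<union> B)) (- (A \<union> B))"
    by (subst bij_betw_cong[where g = id]) (auto simp: bij_betw_def)
  have "bij_betw ?g (A \<union> (B - A) \<union> - (A \<union> B)) (B \<union> (A - B) \<union> - (A \<union> B))"
    by (intro bij_betw_combine g1 g2 g3) auto
  then have "bij ?g" by (auto simp: Un_assoc Un_commute Compl_eq_Diff_UNIV elim!: back_subst[of "bij_betw _ _"] back_subst[of "\<lambda>X. bij_betw _ X _"])
  then show ?thesis using that by simp
qed

definition labelled_spheres :: "nat set \<Rightarrow> nat \<Rightarrow> (nat list list \<times> (nat \<Rightarrow> nat)) set" where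
  "labelled_spheres A K = {(Fs, \<iota>). length Fs = K \<and> dset (mset Fs) = A \<and> sphere (mset Fs) \<iota>}"

lemma finite_labelled_spheres:
  assumes "finite A" shows "finite (labelled_spheres A K)"
proof (rule finite_subset)
  let ?L = "{xs. set xs \<subseteq> A \<and> length xs \<le> card A}"
  have "length F \<le> card A" if "simple (mset Fs)" "F \<in> set Fs" "dset (mset Fs) = A" for F Fs
  proof -
    have "distinct F" "set F \<subseteq> A"
      using that unfolding simple_mset dset_mset by (auto simp: distinct_concat_iff)
    then show ?thesis using assms by (metis card_mono distinct_card)
  qed
  then show "labelled_spheres A K \<subseteq> {Fs. set Fs \<subseteq> ?L \<and> length Fs = K} \<times> {\<iota>. \<iota> permutes A}"
    by (auto simp: labelled_spheres_def sphere_def dset_iff intro: matching_permutes)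
  show "finite ({Fs. set Fs \<subseteq> ?L \<and> length Fs = K} \<times> {\<iota>. \<iota> permutes A})"
    using assms by (intro finite_cartesian_product finite_lists_length_eq finite_permutations
        finite_lists_length_le)
qed

text \<open>A labelling is an enumeration \<open>L\<close> of \<open>A\<close>, recovered as the
  concatenation of the faces. The predicate \<open>Q\<close> on face lengths lets one bijection
  serve both for the full count and for the count with prescribed first length.\<close>

lemma card_labelled_spheres_filter:
  assumes A: "card A = 2 * N" and N: "N \<ge> 1" and K: "K \<ge> 1"
  shows "card {(Fs, \<iota>). (Fs, \<iota>) \<in> labelled_spheres A K \<and> Q (map length Fs)}
    = fact (2 * N) * card {(ms, \<iota>). (ms, \<iota>) \<in> connected_data 0 N K \<and> Q ms}"
proof -
  let ?n = "2 * N"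
  have fin: "finite A" using A N by (auto intro: card_ge_0_finite)
  \<comment> \<open>For each word \<open>L\<close> one renaming that replaces the standard labels by
    \<open>L\<close> is fixed once and for all.\<close>
  have "\<exists>g. bij g \<and> map g [1..<?n + 1] = L" if L: "L \<in> permutations_of_set A" for L
  proof -
    from L have L: "set L = A" "distinct L" "length L = ?n"
      using A by (auto simp: permutations_of_set_def distinct_card)
    have "bij_betw (\<lambda>i. L ! (i - 1)) {1..?n} A"
    proof -
      have "bij_betw (\<lambda>i. i - 1) {1..?n} {..<?n}"
        by (rule bij_betw_byWitness[where f' = Suc]) auto
      moreover have "bij_betw ((!) L) {..<?n} A"
        using bij_betw_nth[OF L(2)] L by auto
      ultimately show ?thesis by (rule bij_betw_trans[unfolded comp_def])
    qed
    then obtain g where "bij g" "\<And>x. x \<in> {1..?n} \<Longrightarrow> g x = L ! (x - 1)"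
      by (rule bij_extension) auto
    moreover from this(2) have "map g [1..<?n + 1] = L"
      using L by (intro nth_equalityI) (auto simp del: upt_Suc)
    ultimately show ?thesis by blast
  qed
  then obtain g where g: "\<And>L. L \<in> permutations_of_set A \<Longrightarrow> bij (g L)"
      "\<And>L. L \<in> permutations_of_set A \<Longrightarrow> map (g L) [1..<?n + 1] = L"
    by metis
  let ?D = "{(ms, \<iota>). (ms, \<iota>) \<in> connected_data 0 N K \<and> Q ms}"
  let ?E = "{(Fs, \<iota>). (Fs, \<iota>) \<in> labelled_spheres A K \<and> Q (map length Fs)}"
  let ?\<Phi> = "\<lambda>((ms, \<iota>), L). (map (map (g L)) (intervals ms), g L \<circ> \<iota> \<circ> inv' (g L))"
  have D: "(ms, \<iota>) \<in> ?D \<longleftrightarrow> length ms = K \<and> sum_list ms = ?n \<and> sphere (mset (intervals ms)) \<iota> \<and> Q ms"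
    for ms \<iota> using connected_data_iff_sphere[OF N K] by auto
  have len: "map length (map (map f) (intervals ms)) = ms" for f :: "nat \<Rightarrow> nat" and ms
    using map_length_intervals[of ms] by (simp add: comp_def)
  have conc: "concat (map (map (g L)) (intervals ms)) = L"
    if "L \<in> permutations_of_set A" "sum_list ms = ?n" for L ms
    using g(2)[OF that(1)] unfolding map_concat[symmetric] concat_intervals that(2) .
  have "bij_betw ?\<Phi> (?D \<times> permutations_of_set A) ?E"
  proof (rule bij_betw_imageI)
    show "inj_on ?\<Phi> (?D \<times> permutations_of_set A)"
    proof (rule inj_onI)
      fix e e'
      assume "e \<in> ?D \<times> permutations_of_set A" "e' \<in> ?D \<times> permutations_of_set A" "?\<Phi> e = ?\<Phi> e'"
      then obtain ms \<iota> L ms' \<iota>' L' where e: "e = ((ms, \<iota>), L)" "e' = ((ms', \<iota>'), L')"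
        and LL: "L \<in> permutations_of_set A" "L' \<in> permutations_of_set A"
        and cd: "(ms, \<iota>) \<in> connected_data 0 N K" "(ms', \<iota>') \<in> connected_data 0 N K" 
        and eq: "map (map (g L)) (intervals ms) = map (map (g L')) (intervals ms')"
        and eq2: "g L \<circ> \<iota> \<circ> inv' (g L) = g L' \<circ> \<iota>' \<circ> inv' (g L')"
        by auto
      have "ms = ms'" using arg_cong[OF eq, of "map length"] unfolding len .
      moreover have "L = L'"
        using arg_cong[OF eq, of concat] conc[OF LL(1)] conc[OF LL(2)] cd
          connected_data_iff_sphere[OF N K] by auto
      moreover have "\<iota> = \<iota>'"
      proof
        fix x
        have b: "bij (g L)" by (rule g(1)[OF LL(1)])
        have "(g L \<circ> \<iota> \<circ> inv' (g L)) (g L x) = (g L \<circ> \<iota>' \<circ> inv' (g L)) (g L x)"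
          using eq2 \<open>L = L'\<close> by simp
        then show "\<iota> x = \<iota>' x" using b by (simp add: bij_is_inj inj_eq)
      qed
      ultimately show "e = e'" by (simp add: e)
    qed
    show "?\<Phi> ` (?D \<times> permutations_of_set A) = ?E"
    proof (intro equalityI subsetI)
      fix e assume "e \<in> ?\<Phi> ` (?D \<times> permutations_of_set A)"
      then obtain ms \<iota> L where e: "e = (map (map (g L)) (intervals ms), g L \<circ> \<iota> \<circ> inv' (g L))"
        and D': "(ms, \<iota>) \<in> ?D" and L: "L \<in> permutations_of_set A" by auto
      have b: "bij (g L)" by (rule g(1)[OF L])
      have "sphere (image_mset (map (g L)) (mset (intervals ms))) (g L \<circ> \<iota> \<circ> inv' (g L))"
        using D' unfolding D by (intro sphere_image[OF b, of _ \<iota>]) (simp_all add: b bij_is_inj)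
      moreover have "dset (mset (map (map (g L)) (intervals ms))) = A"
        unfolding dset_mset using conc[OF L] L D' unfolding D by (simp add: permutations_of_set_def)
      ultimately show "e \<in> ?E"
        using D' len[of "g L" ms] arg_cong[OF map_length_intervals[of ms], of length]
        unfolding D e labelled_spheres_def by simp
    next
      fix e assume "e \<in> ?E"
      then obtain Fs \<kappa> where e: "e = (Fs, \<kappa>)" and Fs: "length Fs = K" "dset (mset Fs) = A"
        and sp: "sphere (mset Fs) \<kappa>" and Q: "Q (map length Fs)"
        by (auto simp: labelled_spheres_def)
      define L where "L = concat Fs"
      define ms where "ms = map length Fs"
      have L: "L \<in> permutations_of_set A"
        using Fs sp unfolding L_def sphere_def simple_mset dset_mset permutations_of_set_def by simp
      then have sum: "sum_list ms = ?n"
        using A distinct_card[of L] unfolding ms_def L_def permutations_of_set_def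
        by (simp add: length_concat)
      have b: "bij (g L)" by (rule g(1)[OF L])
      then have b': "bij (inv' (g L))" by (rule bij_imp_bij_inv)
      define \<iota> where "\<iota> = inv' (g L) \<circ> \<kappa> \<circ> g L"
      have Feq: "map (map (g L)) (intervals ms) = Fs"
        by (rule concat_map_length_eqI) (use conc[OF L sum] len in \<open>simp_all add: L_def ms_def\<close>)
      have "inv' (g L) \<circ> g L = id" using b by (simp add: bij_is_inj)
      then have Feq': "map (map (inv' (g L))) Fs = intervals ms"
        unfolding Feq[symmetric] by (simp add: comp_def fun_eq_iff)
      have "sphere (image_mset (map (inv' (g L))) (mset Fs)) \<iota>"
        by (rule sphere_image[OF b' _ sp]) (simp add: \<iota>_def b bij_is_surj surj_f_inv_f)
      then have "sphere (mset (intervals ms)) \<iota>" using Feq' by (metis mset_map)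
      then have "(ms, \<iota>) \<in> ?D" unfolding D using sum Fs Q by (simp add: ms_def)
      moreover have "g L \<circ> \<iota> \<circ> inv' (g L) = \<kappa>"
        by (auto simp: \<iota>_def fun_eq_iff b bij_is_surj surj_f_inv_f)
      ultimately show "e \<in> ?\<Phi> ` (?D \<times> permutations_of_set A)"
        using L Feq e by force
    qed
  qed
  then have "card ?E = card (?D \<times> permutations_of_set A)" by (simp add: bij_betw_same_card)
  then show ?thesis using A fin by (simp add: card_cartesian_product)
qed

lemma even_card_of_sphere: "sphere M \<iota> \<Longrightarrow> even (card (dset M))"
  by (metis sphere_def dvd_triv_left even_add even_numeral)

text \<open>The value 0 for odd \<open>n\<close> is the true count, since a sphere has an even
  number of darts; sums may thus run over all subsets of labels.\<close>

definition labelled_number :: "nat \<Rightarrow> nat \<Rightarrow> nat" where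
  "labelled_number n K = (if even n then fact n * eps 0 (n div 2) K else 0)"

lemma card_labelled_spheres:
  assumes fin: "finite A" and K: "K \<ge> 1"
  shows "card (labelled_spheres A K) = labelled_number (card A) K"
proof (cases "even (card A)")
  case False
  then have "labelled_spheres A K = {}"
    using even_card_of_sphere by (auto simp: labelled_spheres_def)
  then show ?thesis using False by (simp add: labelled_number_def)
next
  case True
  then obtain N where N: "card A = 2 * N" by (rule evenE)
  show ?thesis
  proof (cases "N = 0")
    case False
    then show ?thesis
      using card_labelled_spheres_filter[OF N, of K "\<lambda>_. True"] K N
      by (simp add: labelled_number_def eps_def)
  next
    case True
    then have A: "A = {}" using N fin by simp
    \<comment> \<open>The convention that \<open>eps 0 0 1\<close> is 1 is realised by the empty
      polygon with its one vertex.\<close>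
    have one: "sphere {#[]#} \<iota> \<longleftrightarrow> \<iota> = id" for \<iota> :: "nat \<Rightarrow> nat"
      by (auto simp: sphere_def simple_add_mset matching_def conn_def vertices_def cycle_count_def
          fun_eq_iff single_is_union)
    have "labelled_spheres A K = (if K = 1 then {([[]], id)} else {})"
    proof -
      have *: "K = 1 \<and> Fs = [[]]" if len: "length Fs = K" and "dset (mset Fs) = {}" "sphere (mset Fs) \<iota>" for Fs \<iota>
      proof -
        obtain F Fs' where Fs: "Fs = F # Fs'" using len K by (cases Fs) simp_all
        then have "F = []" using that by simp
        have "\<iota> ` dset {#F#} \<subseteq> dset {#F#}" "mset Fs = {#F#} + mset Fs'" using Fs \<open>F = []\<close> by simp_all
        then have "mset Fs' = {#}"
          using that unfolding sphere_def conn_def by (metis add_mset_not_empty)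
        then show ?thesis using Fs \<open>F = []\<close> that by simp
      qed
      have "(Fs, \<iota>) \<in> labelled_spheres A K \<longleftrightarrow> K = 1 \<and> Fs = [[]] \<and> \<iota> = id" for Fs \<iota>
      proof
        assume "(Fs, \<iota>) \<in> labelled_spheres A K"
        then have sp: "sphere (mset Fs) \<iota>" and "K = 1" "Fs = [[]]"
          using *[of Fs \<iota>] by (auto simp: labelled_spheres_def A)
        then show "K = 1 \<and> Fs = [[]] \<and> \<iota> = id" using one by simp
      next
        assume "K = 1 \<and> Fs = [[]] \<and> \<iota> = id"
        then show "(Fs, \<iota>) \<in> labelled_spheres A K" using one by (simp add: labelled_spheres_def A)
      qed
      then show ?thesis by auto
    qed
    then show ?thesis using A by (simp add: labelled_number_def eps_def)
  qed
qed

section \<open>Removing the root edge: both sides on one face\<close>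

lemma sum_Pow_card:
  fixes f :: "nat \<Rightarrow> nat"
  assumes "finite A"
  shows "(\<Sum>B\<in>Pow A. f (card B)) = (\<Sum>j\<le>card A. (card A choose j) * f j)"
proof -
  have "(\<Sum>B\<in>Pow A. f (card B)) = (\<Sum>j\<le>card A. \<Sum>B\<in>{B \<in> Pow A. card B = j}. f (card B))"
    by (rule sum.group[symmetric]) (use assms in \<open>auto intro: card_mono\<close>)
  also have "\<dots> = (\<Sum>j\<le>card A. (card A choose j) * f j)"
    using n_subsets[OF assms] by (intro sum.cong) (simp_all add: Pow_def)
  finally show ?thesis .
qed

lemma sum_even_support:
  fixes h :: "nat \<Rightarrow> nat"
  assumes "\<And>j. odd j \<Longrightarrow> h j = 0"
  shows "(\<Sum>j\<le>2 * m. h j) = (\<Sum>i\<le>m. h (2 * i))"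
  using assms by (induction m) simp_all

text \<open>The product rule of exponential generating functions: the binomial coefficient choosing
  the labels of the first sphere cancels against the factorials of the two parts. Odd subsets
  contribute nothing.\<close>

lemma sum_labelled_spheres_pairs:
  assumes A: "finite A" "card A = 2 * m" and kl: "k \<ge> 1" "l \<ge> 1"
  shows "(\<Sum>B\<in>Pow A. card (labelled_spheres B k) * card (labelled_spheres (A - B) l))
    = fact (2 * m) * (\<Sum>i\<le>m. eps 0 i k * eps 0 (m - i) l)"
proof -
  let ?f = "\<lambda>j. labelled_number j k * labelled_number (2 * m - j) l"
  have "(\<Sum>B\<in>Pow A. card (labelled_spheres B k) * card (labelled_spheres (A - B) l))
      = (\<Sum>B\<in>Pow A. ?f (card B))"
  proof (rule sum.cong[OF refl])
    fix B assume "B \<in> Pow A"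
    then have "finite B" using A by (auto intro: finite_subset)
    then have "card (A - B) = 2 * m - card B"
      using A \<open>B \<in> Pow A\<close> by (simp add: card_Diff_subset)
    then show "card (labelled_spheres B k) * card (labelled_spheres (A - B) l) = ?f (card B)"
      using A kl \<open>finite B\<close> by (simp add: card_labelled_spheres)
  qed
  also have "\<dots> = (\<Sum>j\<le>2 * m. (2 * m choose j) * ?f j)"
    using sum_Pow_card[OF A(1), of ?f] A(2) by simp
  also have "\<dots> = (\<Sum>i\<le>m. (2 * m choose (2 * i)) * ?f (2 * i))"
    by (rule sum_even_support) (simp add: labelled_number_def)
  also have "\<dots> = (\<Sum>i\<le>m. fact (2 * m) * (eps 0 i k * eps 0 (m - i) l))"
  proof (rule sum.cong[OF refl])
    fix i assume "i \<in> {..m}"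
    then have "2 * i \<le> 2 * m" and d: "2 * m - 2 * i = 2 * (m - i)" by auto
    from binomial_fact_lemma[OF this(1)]
    have "(2 * m choose (2 * i)) * (fact (2 * i) * fact (2 * (m - i))) = (fact (2 * m) :: nat)"
      unfolding d by (simp add: ac_simps)
    then have "(2 * m choose (2 * i)) * (fact (2 * i) * fact (2 * (m - i))) * (eps 0 i k * eps 0 (m - i) l)
        = fact (2 * m) * (eps 0 i k * eps 0 (m - i) l)" by simp
    then show "(2 * m choose (2 * i)) * ?f (2 * i) = fact (2 * m) * (eps 0 i k * eps 0 (m - i) l)"
      unfolding labelled_number_def d by (simp add: mult.assoc mult.left_commute)
  qed
  finally show ?thesis by (simp add: sum_distrib_left)
qed

lemma matching_comp:
  assumes "matching A \<iota>" "matching B \<kappa>" "A \<inter> B = {}"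
  shows "matching (A \<union> B) (\<iota> \<circ> \<kappa>)"
    and "x \<in> A \<Longrightarrow> (\<iota> \<circ> \<kappa>) x = \<iota> x" and "x \<in> B \<Longrightarrow> (\<iota> \<circ> \<kappa>) x = \<kappa> x"
proof -
  have a: "(\<iota> \<circ> \<kappa>) x = (if x \<in> B then \<kappa> x else \<iota> x)" for x
    using matching_simps[OF assms(1)] matching_simps[OF assms(2)] assms(3)
    by (metis comp_apply disjoint_iff)
  show "matching (A \<union> B) (\<iota> \<circ> \<kappa>)"
    unfolding matching_def a
    using matching_simps[OF assms(1)] matching_simps[OF assms(2)] assms(3)
    by (smt (verit) UnE UnI1 UnI2 disjoint_iff)
  show "x \<in> A \<Longrightarrow> (\<iota> \<circ> \<kappa>) x = \<iota> x" "x \<in> B \<Longrightarrow> (\<iota> \<circ> \<kappa>) x = \<kappa> x"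
    using assms(3) a by auto
qed

lemma matching_transpose: "a \<noteq> b \<Longrightarrow> matching {a, b} (transpose a b)"
  by (auto simp: matching_def transpose_def)

lemma matching_insert_pair:
  assumes "matching (A - {a, b}) \<iota>" "a \<in> A" "b \<in> A" "a \<noteq> b"
  shows "matching A (transpose a b \<circ> \<iota>)" "(transpose a b \<circ> \<iota>) a = b"
    "x \<in> A - {a, b} \<Longrightarrow> (transpose a b \<circ> \<iota>) x = \<iota> x"
proof -
  have A: "{a, b} \<union> (A - {a, b}) = A" using assms by auto
  note m = matching_comp[OF matching_transpose[OF assms(4)] assms(1)]
  show "matching A (transpose a b \<circ> \<iota>)" using m(1) A by simp
  show "(transpose a b \<circ> \<iota>) a = b" using m(2)[of a] by simp
  show "x \<in> A - {a, b} \<Longrightarrow> (transpose a b \<circ> \<iota>) x = \<iota> x" using m(3)[of x] by simp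
qed

lemma matching_eqI:
  assumes "matching A \<iota>" "matching A \<kappa>" "\<And>x. x \<in> A \<Longrightarrow> \<iota> x = \<kappa> x"
  shows "\<iota> = \<kappa>"
  using assms by (metis ext matching_def)

text \<open>Labels for the two sides of the root edge: (n + 2) (n + 1) choices turn the n!
  labellings of the rest into (n + 2)!.\<close>

lemma card_ordered_pairs:
  fixes f :: "'a \<Rightarrow> 'a \<Rightarrow> nat"
  assumes A: "finite A" "card A = Suc (Suc n)" and f: "\<And>a b. a \<in> A \<Longrightarrow> b \<in> A - {a} \<Longrightarrow> f a b = fact n * c"
  shows "(\<Sum>a\<in>A. \<Sum>b\<in>A - {a}. f a b) = fact (Suc (Suc n)) * c"
proof -
  have "(\<Sum>a\<in>A. \<Sum>b\<in>A - {a}. f a b) = (\<Sum>a\<in>A. \<Sum>b\<in>A - {a}. fact n * c)"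
    using f by (intro sum.cong refl) auto
  also have "\<dots> = (\<Sum>a\<in>A. Suc n * (fact n * c))"
    using A by (intro sum.cong refl) (simp add: card_Diff_singleton)
  finally show ?thesis using A by (simp add: algebra_simps)
qed

text \<open>\<open>G\<close> collects the other faces that end up on the same sphere as the piece \<open>ys\<close>.\<close>

definition loop_cut :: "nat list list \<Rightarrow> (nat \<Rightarrow> nat) \<Rightarrow> nat list multiset \<Rightarrow> bool" where
  "loop_cut Fs \<iota> G \<longleftrightarrow> (\<exists>a ys b zs R. Fs = (a # ys @ b # zs) # R \<and> \<iota> a = b
     \<and> \<iota> ` dset (add_mset ys G) \<subseteq> dset (add_mset ys G))"

text \<open>The faces in \<open>G\<close> but not in \<open>G'\<close> form a part closed under
  \<open>\<iota>\<close> that avoids the root face, so connectedness makes it empty, and likewise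
  with the roles exchanged. Distinct distributions of the other faces therefore give disjoint
  cases.\<close>

lemma loop_cut_unique:
  assumes sp: "sphere (mset Fs) \<iota>" and G: "loop_cut Fs \<iota> G" "G \<subseteq># mset (tl Fs)"
    and G': "loop_cut Fs \<iota> G'" "G' \<subseteq># mset (tl Fs)"
  shows "G = G'"
proof -
  from G(1) obtain a ys b zs R where Fs: "Fs = (a # ys @ b # zs) # R" and ab: "\<iota> a = b"
    and cl: "\<iota> ` dset (add_mset ys G) \<subseteq> dset (add_mset ys G)" unfolding loop_cut_def by blast
  from G'(1) obtain ys' zs' where F: "ys @ b # zs = ys' @ b # zs'"
    and cl': "\<iota> ` dset (add_mset ys' G') \<subseteq> dset (add_mset ys' G')"
    using ab unfolding loop_cut_def Fs by auto
  have s: "simple (mset Fs)" and m: "matching (dset (mset Fs)) \<iota>" and c: "conn (mset Fs) \<iota>"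
    using sp by (auto simp: sphere_def)
  have "b \<notin> set ys" "b \<notin> set zs" using s unfolding Fs by (auto simp: simple_add_mset)
  then have ys': "ys' = ys" using F by (simp add: append_Cons_eq_iff)
  obtain H H' where H: "mset R = G + H" "mset R = G' + H'"
    using G(2) G'(2) unfolding Fs by (auto simp: mset_subset_eq_exists_conv)
  \<comment> \<open>\<open>P\<close> is the difference of the two choices. The claim is stated for
    arbitrary choices because it is applied once in each direction.\<close>
  have sub: "P = {#}" if P: "G = Q + P" "H' = P + Q'" "G' + H' = G + H"
    and clP: "\<iota> ` dset (add_mset ys G) \<subseteq> dset (add_mset ys G)"
      "\<iota> ` dset (add_mset ys G') \<subseteq> dset (add_mset ys G')"
      and R: "mset R = G + H" "mset R = G' + H'" "G' = Q + T" "H = T + Q'"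
    for G G' H H' P Q Q' T
  proof -
    have eq: "dset P = dset (add_mset ys G) - dset (add_mset ys G')"
      using s unfolding Fs by (auto simp: simple_add_mset simple_union R P)
    have "\<iota> ` dset P \<subseteq> dset P"
    proof
      fix y assume "y \<in> \<iota> ` dset P"
      then obtain x where x: "y = \<iota> x" "x \<in> dset (add_mset ys G)" "x \<notin> dset (add_mset ys G')"
        unfolding eq by auto
      then have "y \<in> dset (add_mset ys G)" using clP by auto
      moreover have "y \<notin> dset (add_mset ys G')"
        using clP(2) x matching_simps(1)[OF m, of x] by (metis image_subset_iff)
      ultimately show "y \<in> dset P" unfolding eq by simp
    qed
    moreover have "mset Fs = P + add_mset (a # ys @ b # zs) (G' + Q')"
      using Fs R P by (simp add: ac_simps)
    ultimately show "P = {#}" using c unfolding conn_def by (metis add_mset_not_empty)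
  qed
  have "G' + H' = G + H" using H by simp
  then obtain P1 P2 Q1 Q2 where r: "G' = P1 + P2" "H' = Q1 + Q2" "G = P1 + Q1" "H = P2 + Q2"
    using add_eq_add_refine by metis
  note cl' = cl'[unfolded ys']
  have "Q1 = {#}" by (rule sub[of G P1 Q1 H' Q2 G' H P2]) (use r H cl cl' in simp_all)
  moreover have "P2 = {#}" by (rule sub[of G' P1 P2 H Q2 G H' Q1]) (use r H cl cl' in simp_all)
  ultimately show ?thesis using r by simp
qed

text \<open>The side of \<open>ys\<close> receives the first \<open>k\<close> of the other faces, so
  that list order separates the two spheres.\<close>

definition loop_spheres :: "nat set \<Rightarrow> nat \<Rightarrow> nat \<Rightarrow> (nat list list \<times> (nat \<Rightarrow> nat)) set" where
  "loop_spheres A k l = {(Fs, \<iota>) \<in> labelled_spheres A (Suc (k + l)).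
     loop_cut Fs \<iota> (mset (take k (tl Fs)))}"

lemma labelled_spheres_SucE:
  assumes "(Fs, \<iota>) \<in> labelled_spheres A (Suc k)"
  obtains F R where "Fs = F # R" "length R = k" "sphere (add_mset F (mset R)) \<iota>"
    "dset (add_mset F (mset R)) = A"
  using assms by (cases Fs) (auto simp: labelled_spheres_def)

lemma labelled_spheres_matching: "(Fs, \<iota>) \<in> labelled_spheres A k \<Longrightarrow> matching A \<iota>"
  by (auto simp: labelled_spheres_def sphere_def)

text \<open>The data after deletion are the ordered pair of root labels, the label set
  \<open>B\<close> of the side of \<open>ys\<close>, and one sphere on each side whose first face is
  a piece of the root face. A piece may be empty: then its sphere has no labels, or the piece would
  be a separate component.\<close>

lemma card_loop_spheres:
  assumes A: "finite A" "card A = 2 * Suc m"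
  shows "card (loop_spheres A k l)
    = fact (2 * Suc m) * (\<Sum>i\<le>m. eps 0 i (Suc k) * eps 0 (m - i) (Suc l))"
proof -
  let ?T = "SIGMA a:A. SIGMA b:A - {a}. SIGMA B:Pow (A - {a, b}).
    labelled_spheres B (Suc k) \<times> labelled_spheres (A - {a, b} - B) (Suc l)"
  \<comment> \<open>The heads are the two pieces of the root face. \<open>B\<close> does not enter
    the value; it is recovered as the set of labels of \<open>G\<close>.\<close>
  let ?\<Psi> = "\<lambda>(a, b, B, (G, \<iota>), (H, \<kappa>)).
    ((a # hd G @ b # hd H) # tl G @ tl H, transpose a b \<circ> (\<iota> \<circ> \<kappa>))"
  have glue: "matching A (transpose a b \<circ> (\<iota> \<circ> \<kappa>))" "(transpose a b \<circ> (\<iota> \<circ> \<kappa>)) a = b"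
     "perm_restrict (transpose a b \<circ> (\<iota> \<circ> \<kappa>)) B = \<iota>"
     "perm_restrict (transpose a b \<circ> (\<iota> \<circ> \<kappa>)) (A - {a, b} - B) = \<kappa>"
    if ab: "a \<in> A" "b \<in> A - {a}" and B: "B \<subseteq> A - {a, b}"
      and m: "matching B \<iota>" "matching (A - {a, b} - B) \<kappa>" for a b B \<iota> \<kappa>
  proof -
    have "B \<inter> (A - {a, b} - B) = {}" by auto
    note mc = matching_comp[OF m this]
    have "B \<union> (A - {a, b} - B) = A - {a, b}" using B by auto
    then have m': "matching (A - {a, b}) (\<iota> \<circ> \<kappa>)" using mc(1) by simp
    have "a \<noteq> b" "b \<in> A" using ab by auto
    note mi = matching_insert_pair[OF m' ab(1) this(2,1)]
    show "matching A (transpose a b \<circ> (\<iota> \<circ> \<kappa>))" "(transpose a b \<circ> (\<iota> \<circ> \<kappa>)) a = b"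
      by (rule mi)+
    show "perm_restrict (transpose a b \<circ> (\<iota> \<circ> \<kappa>)) B = \<iota>"
    proof
      fix x show "perm_restrict (transpose a b \<circ> (\<iota> \<circ> \<kappa>)) B x = \<iota> x"
        using mi(3)[of x] mc(2)[of x] subsetD[OF B, of x] matching_simps(2)[OF m(1), of x]
        unfolding perm_restrict_def by auto
    qed
    show "perm_restrict (transpose a b \<circ> (\<iota> \<circ> \<kappa>)) (A - {a, b} - B) = \<kappa>"
    proof
      fix x show "perm_restrict (transpose a b \<circ> (\<iota> \<circ> \<kappa>)) (A - {a, b} - B) x = \<kappa> x"
        using mi(3)[of x] mc(3)[of x] matching_simps(2)[OF m(2), of x]
        unfolding perm_restrict_def by auto
    qed
  qed
  have "bij_betw ?\<Psi> ?T (loop_spheres A k l)"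
  proof (rule bij_betw_imageI)
    show "inj_on ?\<Psi> ?T"
    proof (rule inj_onI)
      fix t t' assume "t \<in> ?T" "t' \<in> ?T" and eq: "?\<Psi> t = ?\<Psi> t'"
      obtain a b B G \<iota> H \<kappa> where t: "t = (a, b, B, (G, \<iota>), (H, \<kappa>))"
        by (metis surj_pair)
      have ab: "a \<in> A" "b \<in> A - {a}" and B: "B \<subseteq> A - {a, b}"
        and G: "(G, \<iota>) \<in> labelled_spheres B (Suc k)"
        and H: "(H, \<kappa>) \<in> labelled_spheres (A - {a, b} - B) (Suc l)"
        using \<open>t \<in> ?T\<close> unfolding t by simp_all
      obtain a' b' B' G' \<iota>' H' \<kappa>' where t': "t' = (a', b', B', (G', \<iota>'), (H', \<kappa>'))"
        by (metis surj_pair)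
      have ab': "a' \<in> A" "b' \<in> A - {a'}" and B': "B' \<subseteq> A - {a', b'}"
        and G': "(G', \<iota>') \<in> labelled_spheres B' (Suc k)"
        and H': "(H', \<kappa>') \<in> labelled_spheres (A - {a', b'} - B') (Suc l)"
        using \<open>t' \<in> ?T\<close> unfolding t' by simp_all
      have m: "matching B \<iota>" "matching B' \<iota>'" "matching (A - {a, b} - B) \<kappa>"
        "matching (A - {a', b'} - B') \<kappa>'"
        by (rule labelled_spheres_matching, fact)+
      note g = glue[OF ab B m(1,3)] and g' = glue[OF ab' B' m(2,4)]
      have i: "transpose a b \<circ> (\<iota> \<circ> \<kappa>) = transpose a' b' \<circ> (\<iota>' \<circ> \<kappa>')"
        and F: "a # hd G @ b # hd H = a' # hd G' @ b' # hd H'" and R: "tl G @ tl H = tl G' @ tl H'"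
        using eq unfolding t t' by auto
      have aa: "a = a'" using F by simp
      have bb: "b = b'" using g(2) g'(2) i aa by metis
      obtain ys Gs where G1: "G = ys # Gs" "length Gs = k" "dset (add_mset ys (mset Gs)) = B"
        using labelled_spheres_SucE[OF G] by metis
      obtain ys' Gs' where G1': "G' = ys' # Gs'" "length Gs' = k" "dset (add_mset ys' (mset Gs')) = B'"
        using labelled_spheres_SucE[OF G'] by metis
      obtain zs Hs where H1: "H = zs # Hs" "length Hs = l"
        "dset (add_mset zs (mset Hs)) = A - {a, b} - B"
        using labelled_spheres_SucE[OF H] by metis
      obtain zs' Hs' where H1': "H' = zs' # Hs'" "length Hs' = l"
        using labelled_spheres_SucE[OF H'] by metis
      have "set ys \<subseteq> B" "set zs \<subseteq> A - {a, b} - B" using G1(3) H1(3) by auto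
      \<comment> \<open>As \<open>b\<close> occurs only once in the root face, it marks where the
        two pieces are separated.\<close>
      then have "b \<notin> set ys" "b \<notin> set zs" using B by blast+
      moreover have "ys @ b # zs = ys' @ b # zs'" using F bb G1(1) G1'(1) H1(1) H1'(1) by simp
      ultimately have "ys' = ys" "zs' = zs" by (simp_all add: append_Cons_eq_iff)
      moreover have "Gs = Gs'" "Hs = Hs'" using R G1(1,2) G1'(1,2) H1(1,2) H1'(1,2) by simp_all
      ultimately have GH: "G = G'" "H = H'" and BB: "B = B'"
        using G1 G1' H1(1) H1'(1) by simp_all
      have "\<iota> = \<iota>'" using g(3) g'(3) i BB by metis
      moreover have "\<kappa> = \<kappa>'" using g(4) g'(4) i BB aa bb by metis
      ultimately show "t = t'" using t t' aa bb BB GH by simp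
    qed
    show "?\<Psi> ` ?T = loop_spheres A k l"
    proof (intro equalityI subsetI)
      fix e assume "e \<in> ?\<Psi> ` ?T"
      then obtain t where "t \<in> ?T" "e = ?\<Psi> t" by blast
      obtain a b B G \<iota> H \<kappa> where t: "t = (a, b, B, (G, \<iota>), (H, \<kappa>))"
        by (metis surj_pair)
      have ab: "a \<in> A" "b \<in> A - {a}" and B: "B \<subseteq> A - {a, b}"
        and G: "(G, \<iota>) \<in> labelled_spheres B (Suc k)"
        and H: "(H, \<kappa>) \<in> labelled_spheres (A - {a, b} - B) (Suc l)"
        using \<open>t \<in> ?T\<close> unfolding t by simp_all
      have e: "e = ((a # hd G @ b # hd H) # tl G @ tl H, transpose a b \<circ> (\<iota> \<circ> \<kappa>))"
        using \<open>e = ?\<Psi> t\<close> by (simp add: t)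
      have m: "matching B \<iota>" "matching (A - {a, b} - B) \<kappa>"
        by (rule labelled_spheres_matching, fact)+
      note g = glue[OF ab B m]
      let ?i = "transpose a b \<circ> (\<iota> \<circ> \<kappa>)"
      obtain ys Gs where G1: "G = ys # Gs" "length Gs = k" "sphere (add_mset ys (mset Gs)) \<iota>"
        "dset (add_mset ys (mset Gs)) = B"
        using labelled_spheres_SucE[OF G] by metis
      obtain zs Hs where H1: "H = zs # Hs" "length Hs = l" "sphere (add_mset zs (mset Hs)) \<kappa>"
        "dset (add_mset zs (mset Hs)) = A - {a, b} - B"
        using labelled_spheres_SucE[OF H] by metis
      have sY: "simple (add_mset ys (mset Gs))" and sZ: "simple (add_mset zs (mset Hs))"
        using G1 H1 by (auto simp: sphere_def)
      have "dset (add_mset ys (mset Gs)) \<inter> dset (add_mset zs (mset Hs)) = {}"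
        unfolding G1(4) H1(4) by auto
      then have "simple (add_mset ys (mset Gs) + add_mset zs (mset Hs))"
        using sY sZ by (simp only: simple_union simp_thms)
      moreover have "a \<notin> dset (add_mset ys (mset Gs))" "b \<notin> dset (add_mset ys (mset Gs))"
        "a \<notin> dset (add_mset zs (mset Hs))" "b \<notin> dset (add_mset zs (mset Hs))"
        unfolding G1(4) H1(4) using B by auto
      moreover have "a \<noteq> b" using ab by auto
      ultimately have s: "simple (add_mset (a # ys @ b # zs) (mset Gs + mset Hs))"
        by (auto simp: simple_add_mset simple_union)
      have "dset (add_mset (a # ys @ b # zs) (mset Gs + mset Hs))
          = {a, b} \<union> dset (add_mset ys (mset Gs)) \<union> dset (add_mset zs (mset Hs))" by auto
      also have "\<dots> = A" unfolding G1(4) H1(4) using ab B by auto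
      finally have d: "dset (add_mset (a # ys @ b # zs) (mset Gs + mset Hs)) = A" .
      have cl: "?i ` dset (add_mset ys (mset Gs)) \<subseteq> dset (add_mset ys (mset Gs))"
      proof
        fix y assume "y \<in> ?i ` dset (add_mset ys (mset Gs))"
        then obtain x where x: "x \<in> B" "y = ?i x" unfolding G1(4) by blast
        then have "y = \<iota> x" using fun_cong[OF g(3), of x] by (simp add: perm_restrict_def)
        then show "y \<in> dset (add_mset ys (mset Gs))"
          unfolding G1(4) using x matching_simps(3)[OF m(1)] by simp
      qed
      have "sphere (add_mset (a # ys @ b # zs) (mset Gs + mset Hs)) ?i"
        using sphere_cut_loop[OF s _ g(2) cl] g(1) unfolding d G1(4) H1(4) g(3,4)
        using G1(3) H1(3) by blast
      then show "e \<in> loop_spheres A k l"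
        using d g(2) cl G1 H1 unfolding e loop_spheres_def labelled_spheres_def loop_cut_def
        by (auto intro!: exI)
    next
      fix e assume "e \<in> loop_spheres A k l"
      then obtain Fs i where e: "e = (Fs, i)" "(Fs, i) \<in> labelled_spheres A (Suc (k + l))"
        "loop_cut Fs i (mset (take k (tl Fs)))" by (auto simp: loop_spheres_def)
      then obtain a ys b zs R where Fs: "Fs = (a # ys @ b # zs) # R" and ab: "i a = b"
        and cl0: "i ` dset (add_mset ys (mset (take k R))) \<subseteq> dset (add_mset ys (mset (take k R)))"
        unfolding loop_cut_def by auto
      define Gs Hs where "Gs = take k R" and "Hs = drop k R"
      have R: "R = Gs @ Hs" by (simp add: Gs_def Hs_def)
      have len: "length Gs = k" "length Hs = l"
        using e(2) by (auto simp: labelled_spheres_def Fs Gs_def Hs_def)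
      note cl = cl0[folded Gs_def]
      let ?S = "add_mset (a # ys @ b # zs) (mset Gs + mset Hs)"
      have sp: "sphere ?S i" and d: "dset ?S = A"
        using e(2) unfolding labelled_spheres_def Fs R by auto
      have s: "simple ?S" and m: "matching (dset ?S) i" using sp by (auto simp: sphere_def)
      define B where "B = dset (add_mset ys (mset Gs))"
      define C where "C = dset (add_mset zs (mset Hs))"
      note clC = conn_cut_loop(1)[OF s m ab cl, folded C_def]
      have abA: "a \<in> A" "b \<in> A - {a}"
        using d s by (auto simp: simple_add_mset)
      have C: "C = A - {a, b} - B" and B: "B \<subseteq> A - {a, b}"
        using s unfolding B_def C_def d[symmetric] by (auto simp: simple_add_mset simple_union)
      have sps: "sphere (add_mset ys (mset Gs)) (perm_restrict i B)"
        "sphere (add_mset zs (mset Hs)) (perm_restrict i C)"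
        using sphere_cut_loop[OF s m ab cl] sp unfolding B_def C_def by auto
      then have mB: "matching B (perm_restrict i B)" and mC: "matching (A - {a, b} - B) (perm_restrict i C)"
        unfolding sphere_def B_def[symmetric] C_def[symmetric] C by auto
      note g = glue[OF abA B mB mC]
      have "transpose a b \<circ> (perm_restrict i B \<circ> perm_restrict i C) = i"
      proof (rule matching_eqI[OF g(1) m[unfolded d]])
        let ?j = "transpose a b \<circ> (perm_restrict i B \<circ> perm_restrict i C)"
        fix x assume "x \<in> A"
        then consider "x = a" | "x = b" | "x \<in> B" | "x \<in> C" unfolding C by auto
        then show "?j x = i x"
        proof cases
          case 1
          then show ?thesis using g(2) ab by simp
        next
          case 2
          then show ?thesis
            using g(2) matching_simps(1)[OF g(1), of a] matching_simps(1)[OF m, of a] ab by metis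
        next
          case 3
          then show ?thesis using fun_cong[OF g(3), of x] by (simp add: perm_restrict_def)
        next
          case 4
          then show ?thesis using fun_cong[OF g(4), of x] unfolding C[symmetric] by (simp add: perm_restrict_def)
        qed
      qed
      moreover have "(ys # Gs, perm_restrict i B) \<in> labelled_spheres B (Suc k)"
        "(zs # Hs, perm_restrict i C) \<in> labelled_spheres (A - {a, b} - B) (Suc l)"
        using sps len unfolding C[symmetric] by (auto simp: labelled_spheres_def B_def C_def)
      ultimately show "e \<in> ?\<Psi> ` ?T"
        using abA B unfolding e(1) Fs R
        by (intro image_eqI[of _ _ "(a, b, B, (ys # Gs, perm_restrict i B), (zs # Hs, perm_restrict i C))"])
          auto
    qed
  qed
  then have "card (loop_spheres A k l) = card ?T" by (simp add: bij_betw_same_card)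
  also have "\<dots> = (\<Sum>a\<in>A. \<Sum>b\<in>A - {a}. \<Sum>B\<in>Pow (A - {a, b}).
      card (labelled_spheres B (Suc k)) * card (labelled_spheres (A - {a, b} - B) (Suc l)))"
  proof -
    have fB: "finite B" if "B \<in> Pow (A - {a, b})" for a b B
      using that A(1) by (meson PowD finite_Diff finite_subset)
    have fL: "\<forall>B\<in>Pow (A - {a, b}). finite (labelled_spheres B (Suc k)
        \<times> labelled_spheres (A - {a, b} - B) (Suc l))" for a b
      using fB A(1) by (intro ballI finite_cartesian_product finite_labelled_spheres) auto
    have fP: "finite (Pow (A - {a, b}))" for a b using A(1) by simp
    have fS: "finite (SIGMA B:Pow (A - {a, b}). labelled_spheres B (Suc k)
        \<times> labelled_spheres (A - {a, b} - B) (Suc l))" for a b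
      by (rule finite_SigmaI[OF fP]) (rule fL[rule_format])
    have f2: "finite (SIGMA b:A - {a}. SIGMA B:Pow (A - {a, b}). labelled_spheres B (Suc k)
        \<times> labelled_spheres (A - {a, b} - B) (Suc l))" for a
      by (rule finite_SigmaI) (simp add: A(1), rule fS)
    have "card ?T = (\<Sum>a\<in>A. card (SIGMA b:A - {a}. SIGMA B:Pow (A - {a, b}).
        labelled_spheres B (Suc k) \<times> labelled_spheres (A - {a, b} - B) (Suc l)))"
      by (rule card_SigmaI[OF A(1)]) (intro ballI f2)
    also have "\<dots> = (\<Sum>a\<in>A. \<Sum>b\<in>A - {a}. card (SIGMA B:Pow (A - {a, b}).
        labelled_spheres B (Suc k) \<times> labelled_spheres (A - {a, b} - B) (Suc l)))"
      by (intro sum.cong refl) (rule card_SigmaI, simp add: A(1), intro ballI fS)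
    finally show ?thesis
      unfolding card_SigmaI[OF fP fL] card_cartesian_product .
  qed
  also have "\<dots> = fact (Suc (Suc (2 * m))) * (\<Sum>i\<le>m. eps 0 i (Suc k) * eps 0 (m - i) (Suc l))"
  proof (rule card_ordered_pairs[OF A(1)])
    fix a b assume "a \<in> A" "b \<in> A - {a}"
    then have "card (A - {a, b}) = 2 * m" using A by (simp add: card_Diff_subset)
    from sum_labelled_spheres_pairs[OF _ this, of "Suc k" "Suc l"] A(1)
    show "(\<Sum>B\<in>Pow (A - {a, b}). card (labelled_spheres B (Suc k))
        * card (labelled_spheres (A - {a, b} - B) (Suc l)))
      = fact (2 * m) * (\<Sum>i\<le>m. eps 0 i (Suc k) * eps 0 (m - i) (Suc l))" by simp
  qed (use A in simp)
  finally show ?thesis by simp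
qed

section \<open>Removing the root edge: two different faces\<close>

definition cuts :: "'a list \<Rightarrow> ('a list \<times> 'a list \<times> 'a list) set" where
  "cuts ws = {(xs, ys, zs). ws = xs @ ys @ zs}"

lemma card_splits: "finite {(xs, ys). ws = xs @ ys} \<and> card {(xs, ys). ws = xs @ ys} = Suc (length ws)"
proof (induction ws)
  case Nil
  have "{(xs, ys). ([] :: 'a list) = xs @ ys} = {([], [])}" by auto
  then show ?case by simp
next
  case (Cons w ws)
  let ?f = "\<lambda>(xs, ys). (w # xs, ys)"
  have eq: "{(xs, ys). w # ws = xs @ ys} = insert ([], w # ws) (?f ` {(xs, ys). ws = xs @ ys})"
    by (auto simp: Cons_eq_append_conv image_iff)
  have "inj_on ?f {(xs, ys). ws = xs @ ys}" by (auto simp: inj_on_def)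
  from card_image[OF this] have "card (?f ` {(xs, ys). ws = xs @ ys}) = Suc (length ws)"
    using Cons by simp
  moreover have "([], w # ws) \<notin> ?f ` {(xs, ys). ws = xs @ ys}" by auto
  ultimately show ?case unfolding eq using Cons by simp
qed

text \<open>Words whose first piece is empty are counted by \<open>card_splits\<close>, which yields
  the recurrence of the triangular numbers. The equation stays doubled so that no division
  occurs.\<close>

lemma card_cuts: "finite (cuts ws) \<and> 2 * card (cuts ws) = (length ws + 1) * (length ws + 2)"
proof (induction ws)
  case Nil
  have "cuts ([] :: 'a list) = {([], [], [])}" by (auto simp: cuts_def)
  then show ?case by simp
next
  case (Cons w ws)
  let ?f = "\<lambda>(xs, ys, zs). (w # xs, ys, zs)" and ?g = "\<lambda>(ys, zs). ([], ys, zs)"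
  let ?S = "{(ys, zs). w # ws = ys @ zs}"
  have eq: "cuts (w # ws) = ?g ` ?S \<union> ?f ` cuts ws"
    by (auto simp: cuts_def Cons_eq_append_conv image_iff)
  have "inj_on ?f (cuts ws)" "inj_on ?g ?S" by (auto simp: inj_on_def)
  from card_image[OF this(1)] card_image[OF this(2)]
  have "card (?f ` cuts ws) = card (cuts ws)" "card (?g ` ?S) = Suc (Suc (length ws))"
    using card_splits[of "w # ws"] by simp_all
  moreover have "?g ` ?S \<inter> ?f ` cuts ws = {}" by auto
  ultimately have "card (cuts (w # ws)) = Suc (Suc (length ws)) + card (cuts ws)"
    unfolding eq using Cons card_splits[of "w # ws"] by (subst card_Un_disjoint) auto
  then show ?case using Cons card_splits[of "w # ws"] unfolding eq by simp
qed

definition bridge_spheres :: "nat set \<Rightarrow> nat \<Rightarrow> (nat list list \<times> (nat \<Rightarrow> nat)) set" where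
  "bridge_spheres A k = {(Fs, \<iota>) \<in> labelled_spheres A (Suc (Suc k)). \<iota> (hd (hd Fs)) \<in> set (Fs ! 1)}"

lemma labelled_spheres_nonempty_faces:
  assumes "(Fs, \<iota>) \<in> labelled_spheres A K" "A \<noteq> {}"
  shows "[] \<notin> set Fs"
proof -
  have "sphere (mset Fs) \<iota>" and d: "dset (mset Fs) = A"
    using assms(1) by (auto simp: labelled_spheres_def)
  from sphere_nonempty_faces[OF this(1)] show ?thesis using assms(2) unfolding d by simp
qed

text \<open>The first face starts at the deleted side \<open>a\<close>, but the other deleted side
  \<open>b\<close> may stand anywhere in the second face, with \<open>us\<close> before it and
  \<open>vs\<close> after it. Three pieces are therefore needed to undo the merging.\<close>

lemma card_bridge_spheres:
  assumes A: "finite A" "A \<noteq> {}"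
  shows "card (bridge_spheres A k) = (\<Sum>a\<in>A. \<Sum>b\<in>A - {a}.
    \<Sum>d\<in>labelled_spheres (A - {a, b}) (Suc k). card (cuts (hd (fst d))))"
proof -
  let ?T = "SIGMA a:A. SIGMA b:A - {a}. SIGMA d:labelled_spheres (A - {a, b}) (Suc k). cuts (hd (fst d))"
  let ?\<Psi> = "\<lambda>(a, b, (Gs, \<kappa>), (ys, vs, us)).
    ((a # ys) # (us @ b # vs) # tl Gs, transpose a b \<circ> \<kappa>)"
  have "bij_betw ?\<Psi> ?T (bridge_spheres A k)"
  proof (rule bij_betw_imageI)
    show "inj_on ?\<Psi> ?T"
    proof (rule inj_onI)
      fix t t' assume "t \<in> ?T" "t' \<in> ?T" and eq: "?\<Psi> t = ?\<Psi> t'"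
      obtain a b Gs \<kappa> ys vs us where t: "t = (a, b, (Gs, \<kappa>), (ys, vs, us))" by (metis surj_pair)
      have ab: "a \<in> A" "b \<in> A" "a \<noteq> b" and G: "(Gs, \<kappa>) \<in> labelled_spheres (A - {a, b}) (Suc k)"
        and cut: "hd Gs = ys @ vs @ us"
        using \<open>t \<in> ?T\<close> unfolding t by (simp_all add: cuts_def)
      obtain a' b' Gs' \<kappa>' ys' vs' us' where t': "t' = (a', b', (Gs', \<kappa>'), (ys', vs', us'))"
        by (metis surj_pair)
      have ab': "a' \<in> A" "b' \<in> A" "a' \<noteq> b'"
        and G': "(Gs', \<kappa>') \<in> labelled_spheres (A - {a', b'}) (Suc k)"
        and cut': "hd Gs' = ys' @ vs' @ us'"
        using \<open>t' \<in> ?T\<close> unfolding t' by (simp_all add: cuts_def)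
      have m: "matching (A - {a, b}) \<kappa>" and m': "matching (A - {a', b'}) \<kappa>'"
        by (rule labelled_spheres_matching, fact)+
      have i: "transpose a b \<circ> \<kappa> = transpose a' b' \<circ> \<kappa>'"
        and F: "a = a'" "ys = ys'" "us @ b # vs = us' @ b' # vs'" "tl Gs = tl Gs'"
        using arg_cong[OF eq, of snd] arg_cong[OF eq, of fst] unfolding t t'
        by (simp_all only: prod.case fst_conv snd_conv list.inject)
      have bb: "b = b'"
        using matching_insert_pair(2)[OF m ab] matching_insert_pair(2)[OF m' ab'] i F(1) by metis
      have kk: "\<kappa> = \<kappa>'"
      proof
        fix x
        have "transpose a b (\<kappa> x) = transpose a b (\<kappa>' x)"
          using fun_cong[OF i, of x] by (simp add: F(1) bb)
        then show "\<kappa> x = \<kappa>' x" by (metis transpose_involutory)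
      qed
      obtain X R where X: "Gs = X # R" "dset (add_mset X (mset R)) = A - {a, b}"
        using labelled_spheres_SucE[OF G] by metis
      obtain X' R' where X': "Gs' = X' # R'"
        using labelled_spheres_SucE[OF G'] by metis
      have "set (hd Gs) \<subseteq> A - {a, b}" using X(2) unfolding X(1) by auto
      then have "b \<notin> set us" "b \<notin> set vs" unfolding cut by auto
      then have "us = us'" "vs = vs'" using F(3) unfolding bb by (simp_all add: append_Cons_eq_iff)
      moreover have "Gs = Gs'"
        using F(2,4) cut cut' calculation X(1) X' by simp
      ultimately show "t = t'" using t t' F(1,2) bb kk by simp
    qed
    show "?\<Psi> ` ?T = bridge_spheres A k"
    proof (intro equalityI subsetI)
      fix e assume "e \<in> ?\<Psi> ` ?T"
      then obtain t where "t \<in> ?T" "e = ?\<Psi> t" by blast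
      obtain a b Gs \<kappa> ys vs us where t: "t = (a, b, (Gs, \<kappa>), (ys, vs, us))" by (metis surj_pair)
      have ab: "a \<in> A" "b \<in> A" "a \<noteq> b" and G: "(Gs, \<kappa>) \<in> labelled_spheres (A - {a, b}) (Suc k)"
        and cut: "hd Gs = ys @ vs @ us"
        using \<open>t \<in> ?T\<close> unfolding t by (simp_all add: cuts_def)
      have e: "e = ((a # ys) # (us @ b # vs) # tl Gs, transpose a b \<circ> \<kappa>)"
        using \<open>e = ?\<Psi> t\<close> by (simp add: t)
      obtain W R where W: "Gs = W # R" "length R = k" "sphere (add_mset W (mset R)) \<kappa>"
        "dset (add_mset W (mset R)) = A - {a, b}"
        using labelled_spheres_SucE[OF G] by metis
      have cutW: "W = ys @ vs @ us" using cut W(1) by simp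
      have m: "matching (A - {a, b}) \<kappa>" by (rule labelled_spheres_matching[OF G])
      note mi = matching_insert_pair[OF m ab]
      let ?S = "add_mset (a # ys) (add_mset (us @ b # vs) (mset R))"
      have d: "dset ?S = {a, b} \<union> dset (add_mset W (mset R))" unfolding cutW by auto
      then have d: "dset ?S = A" unfolding W(4) using ab by auto
      have "simple (add_mset W (mset R))" using W(3) by (simp add: sphere_def)
      moreover have "a \<notin> dset (add_mset W (mset R))" "b \<notin> dset (add_mset W (mset R))"
        unfolding W(4) by auto
      ultimately have s: "simple ?S" using ab(3) unfolding cutW by (auto simp: simple_add_mset)
      have mS: "matching (dset ?S) (transpose a b \<circ> \<kappa>)" unfolding d by (rule mi(1))
      have tt: "transpose a b \<circ> (transpose a b \<circ> \<kappa>) = \<kappa>" by (simp add: fun_eq_iff)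
      have "sphere ?S (transpose a b \<circ> \<kappa>)"
        unfolding sphere_cut_bridge[OF s mS mi(2)] tt using W(3) unfolding cutW .
      then show "e \<in> bridge_spheres A k"
        using d W(2) mi(2) unfolding e W(1) bridge_spheres_def labelled_spheres_def by simp
    next
      fix e assume "e \<in> bridge_spheres A k"
      then obtain Fs i where e: "e = (Fs, i)" and L: "(Fs, i) \<in> labelled_spheres A (Suc (Suc k))"
        and br: "i (hd (hd Fs)) \<in> set (Fs ! 1)" by (auto simp: bridge_spheres_def)
      \<comment> \<open>This makes \<open>hd (hd Fs)\<close> an actual dart rather than the
        unspecified head of an empty list.\<close>
      have ne: "[] \<notin> set Fs" by (rule labelled_spheres_nonempty_faces[OF L A(2)])
      obtain F R0 where F: "Fs = F # R0" "length R0 = Suc k" using labelled_spheres_SucE[OF L] by metis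
      then obtain F' R where F': "Fs = F # F' # R" "length R = k" by (auto simp: length_Suc_conv)
      obtain a ys where a: "F = a # ys" using ne F' by (cases F) auto
      define b where "b = i a"
      have "b \<in> set F'" using br F' a by (simp add: b_def)
      then obtain us vs where b: "F' = us @ b # vs" by (meson split_list)
      let ?S = "add_mset (a # ys) (add_mset (us @ b # vs) (mset R))"
      have sp: "sphere ?S i" and d: "dset ?S = A"
        using L unfolding labelled_spheres_def F' a b by auto
      have s: "simple ?S" and m: "matching (dset ?S) i" using sp by (auto simp: sphere_def)
      have sp': "sphere (add_mset (ys @ vs @ us) (mset R)) (transpose a b \<circ> i)"
        using sphere_cut_bridge[OF s m b_def[symmetric]] sp by simp
      have d': "dset (add_mset (ys @ vs @ us) (mset R)) = A - {a, b}"
        using s unfolding d[symmetric] by (auto simp: simple_add_mset)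
      have ab: "a \<in> A" "b \<in> A - {a}" using d s by (auto simp: simple_add_mset)
      have "((ys @ vs @ us) # R, transpose a b \<circ> i) \<in> labelled_spheres (A - {a, b}) (Suc k)"
        using sp' d' F'(2) unfolding labelled_spheres_def by simp
      moreover have "transpose a b \<circ> (transpose a b \<circ> i) = i" by (simp add: fun_eq_iff)
      ultimately show "e \<in> ?\<Psi> ` ?T"
        using ab unfolding e F'(1) a b
        by (intro image_eqI[of _ _ "(a, b, ((ys @ vs @ us) # R, transpose a b \<circ> i), (ys, vs, us))"])
          (auto simp: cuts_def)
    qed
  qed
  then have "card (bridge_spheres A k) = card ?T" by (simp add: bij_betw_same_card)
  also have "\<dots> = (\<Sum>a\<in>A. \<Sum>b\<in>A - {a}.
    \<Sum>d\<in>labelled_spheres (A - {a, b}) (Suc k). card (cuts (hd (fst d))))"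
  proof -
    have fL: "finite (labelled_spheres (A - {a, b}) (Suc k))" for a b
      using A by (intro finite_labelled_spheres) simp
    have fC: "\<forall>d\<in>labelled_spheres (A - {a, b}) (Suc k). finite (cuts (hd (fst d)))" for a b
      using card_cuts by blast
    have f1: "finite (SIGMA d:labelled_spheres (A - {a, b}) (Suc k). cuts (hd (fst d)))" for a b
      by (rule finite_SigmaI[OF fL]) (rule fC[rule_format])
    have f2: "finite (SIGMA b:A - {a}. SIGMA d:labelled_spheres (A - {a, b}) (Suc k). cuts (hd (fst d)))" for a
      by (rule finite_SigmaI) (simp add: A(1), rule f1)
    have "card ?T = (\<Sum>a\<in>A. card (SIGMA b:A - {a}.
        SIGMA d:labelled_spheres (A - {a, b}) (Suc k). cuts (hd (fst d))))"
      by (rule card_SigmaI[OF A(1)]) (intro ballI f2)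
    also have "\<dots> = (\<Sum>a\<in>A. \<Sum>b\<in>A - {a}. card (SIGMA d:labelled_spheres (A - {a, b}) (Suc k).
        cuts (hd (fst d))))"
      by (intro sum.cong refl) (rule card_SigmaI, simp add: A(1), intro ballI f1)
    finally show ?thesis unfolding card_SigmaI[OF fL fC] .
  qed
  finally show ?thesis .
qed

text \<open>Grouped by the length of the first face. Both faces are nonempty and have
  \<open>2 * m\<close> darts together, which gives the range of \<open>i\<close>.\<close>

lemma sum_labelled_spheres_2:
  fixes g :: "nat \<Rightarrow> nat"
  assumes A: "card A = 2 * m" and m: "m \<ge> 1"
  shows "(\<Sum>d\<in>labelled_spheres A 2. g (length (hd (fst d))))
    = fact (2 * m) * (\<Sum>i=1..2 * m - 1. g i * eps_tilde0 (2 * int m) (int i) 2)"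
proof -
  have fin: "finite A" and ne: "A \<noteq> {}" using A m by (auto intro: card_ge_0_finite)
  let ?L = "labelled_spheres A 2"
  have shape: "\<exists>F F'. Fs = [F, F'] \<and> 1 \<le> length F \<and> length F \<le> 2 * m - 1" if L: "(Fs, \<iota>) \<in> ?L" for Fs \<iota>
  proof -
    have "length Fs = 2" using L by (simp add: labelled_spheres_def)
    then obtain F F' where Fs: "Fs = [F, F']" by (auto simp: numeral_2_eq_2 length_Suc_conv)
    have "F \<noteq> []" "F' \<noteq> []" using labelled_spheres_nonempty_faces[OF L ne] Fs by auto
    moreover have "card (dset (mset Fs)) = size (darts (mset Fs))"
      using L by (intro card_dset) (simp add: labelled_spheres_def sphere_def)
    then have "length F + length F' = 2 * m"
      using L A unfolding Fs labelled_spheres_def by simp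
    ultimately show ?thesis using Fs by (cases F; cases F') auto
  qed
  have "(\<Sum>d\<in>?L. g (length (hd (fst d))))
      = (\<Sum>i=1..2 * m - 1. \<Sum>d\<in>{d \<in> ?L. length (hd (fst d)) = i}. g (length (hd (fst d))))"
  proof (rule sum.group[symmetric])
    show "(\<lambda>d. length (hd (fst d))) ` ?L \<subseteq> {1..2 * m - 1}"
      using shape by fastforce
  qed (use finite_labelled_spheres[OF fin] in simp_all)
  also have "\<dots> = (\<Sum>i=1..2 * m - 1. fact (2 * m) * (g i * eps_tilde0 (2 * int m) (int i) 2))"
  proof (rule sum.cong[OF refl])
    fix i
    have "{d \<in> ?L. length (hd (fst d)) = i}
        = {(Fs, \<iota>). (Fs, \<iota>) \<in> ?L \<and> hd (map length Fs) = i}"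
      using shape by fastforce
    then have "card {d \<in> ?L. length (hd (fst d)) = i}
        = fact (2 * m) * card {(ms, \<iota>). (ms, \<iota>) \<in> connected_data 0 m 2 \<and> hd ms = i}"
      using card_labelled_spheres_filter[OF A m, of 2 "\<lambda>ms. hd ms = i"] by simp
    also have "card {(ms, \<iota>). (ms, \<iota>) \<in> connected_data 0 m 2 \<and> hd ms = i}
        = eps_tilde0 (2 * int m) (int i) 2"
      by (simp add: eps_tilde0_def)
    finally show "(\<Sum>d\<in>{d \<in> ?L. length (hd (fst d)) = i}. g (length (hd (fst d))))
        = fact (2 * m) * (g i * eps_tilde0 (2 * int m) (int i) 2)"
      by simp
  qed
  finally show ?thesis by (simp add: sum_distrib_left)
qed

lemma card_bridge_spheres_1:
  assumes A: "card A = 2 * Suc m" and m: "m \<ge> 1"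
  shows "2 * card (bridge_spheres A 1) = fact (2 * Suc m)
    * (\<Sum>i=1..2 * m - 1. (i + 1) * (i + 2) * eps_tilde0 (2 * int m) (int i) 2)"
proof -
  have fin: "finite A" and ne: "A \<noteq> {}" using A by (auto intro: card_ge_0_finite)
  have "2 * card (bridge_spheres A 1) = (\<Sum>a\<in>A. \<Sum>b\<in>A - {a}.
      \<Sum>d\<in>labelled_spheres (A - {a, b}) 2. 2 * card (cuts (hd (fst d))))"
    unfolding card_bridge_spheres[OF fin ne] by (simp add: sum_distrib_left numeral_2_eq_2)
  also have "\<dots> = (\<Sum>a\<in>A. \<Sum>b\<in>A - {a}. \<Sum>d\<in>labelled_spheres (A - {a, b}) 2.
      (\<lambda>p. (p + 1) * (p + 2)) (length (hd (fst d))))"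
    using card_cuts by (intro sum.cong refl) blast
  also have "\<dots> = fact (Suc (Suc (2 * m)))
      * (\<Sum>i=1..2 * m - 1. (i + 1) * (i + 2) * eps_tilde0 (2 * int m) (int i) 2)"
  proof (rule card_ordered_pairs[OF fin])
    show "card A = Suc (Suc (2 * m))" using A by simp
    fix a b assume "a \<in> A" "b \<in> A - {a}"
    then have "card (A - {a, b}) = 2 * m" using A fin by (simp add: card_Diff_subset)
    from sum_labelled_spheres_2[OF this m, of "\<lambda>p. (p + 1) * (p + 2)"]
    show "(\<Sum>d\<in>labelled_spheres (A - {a, b}) 2. (\<lambda>p. (p + 1) * (p + 2)) (length (hd (fst d))))
      = fact (2 * m) * (\<Sum>i=1..2 * m - 1. (i + 1) * (i + 2) * eps_tilde0 (2 * int m) (int i) 2)" .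
  qed
  finally show ?thesis by simp
qed

section \<open>Three faces: assembling the cases\<close>

lemma subset_mset_pair:
  assumes "G \<subseteq># {#x, y#}"
  shows "G = {#} \<or> G = {#x#} \<or> G = {#y#} \<or> G = {#x, y#}"
proof -
  have single: "G' = {#} \<or> G' = {#y#}" if "G' \<subseteq># {#y#}" for G'
    using nonempty_subseteq_mset_eq_single[OF _ that] by metis
  show ?thesis
  proof (cases "x \<in># G")
    case True
    then obtain G' where G: "G = add_mset x G'" by (meson multi_member_split)
    then have "G' \<subseteq># {#y#}" using assms by simp
    from single[OF this] show ?thesis using G by auto
  next
    case False
    have "count G z \<le> count {#y#} z" for z
      using mset_subset_eq_count[OF assms, of z] False by (cases "z = x") (auto simp: not_in_iff)
    then have "G \<subseteq># {#y#}" by (simp add: subseteq_mset_def)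
    from single[OF this] show ?thesis by auto
  qed
qed

text \<open>This symmetry identifies the two ways of placing exactly one other face on the side of
  \<open>ys\<close>, and the two choices of the face across the root edge.\<close>

definition swap_faces :: "nat list list \<times> (nat \<Rightarrow> nat) \<Rightarrow> nat list list \<times> (nat \<Rightarrow> nat)" where
  "swap_faces = (\<lambda>(Fs, \<iota>). ([Fs ! 0, Fs ! 2, Fs ! 1], \<iota>))"

lemma labelled_spheres_3E:
  assumes "d \<in> labelled_spheres A 3"
  obtains F1 F2 F3 \<iota> where "d = ([F1, F2, F3], \<iota>)"
  using assms by (cases d) (auto simp: labelled_spheres_def numeral_3_eq_3 length_Suc_conv)

lemma loop_cut_tail: "loop_cut (F # R) \<iota> G \<Longrightarrow> loop_cut (F # R') \<iota> G"
  by (auto simp: loop_cut_def)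

lemma card_swap_faces:
  "card {d \<in> labelled_spheres A 3. P (swap_faces d)} = card {d \<in> labelled_spheres A 3. P d}"
proof (rule bij_betw_same_card)
  have sw: "swap_faces d \<in> labelled_spheres A 3 \<and> swap_faces (swap_faces d) = d"
    if d: "d \<in> labelled_spheres A 3" for d
  proof -
    obtain F1 F2 F3 \<iota> where "d = ([F1, F2, F3], \<iota>)" using labelled_spheres_3E[OF d] .
    then show ?thesis
      using d by (auto simp: swap_faces_def labelled_spheres_def add_mset_commute[of F2 F3] Un_ac)
  qed
  show "bij_betw swap_faces {d \<in> labelled_spheres A 3. P (swap_faces d)} {d \<in> labelled_spheres A 3. P d}"
    by (rule bij_betw_byWitness[where f' = swap_faces]) (use sw in auto)
qed

text \<open>The far side of the root edge lies on one of the three faces. If it is the first, the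
  multiset separated off with \<open>ys\<close> exists by \<open>sphere_loop_separates\<close>, is
  unique by \<open>loop_cut_unique\<close>, and is one of four.\<close>

lemma card_labelled_spheres_3:
  assumes A: "finite A" "A \<noteq> {}"
  shows "card (labelled_spheres A 3) = card (loop_spheres A 0 2) + 2 * card (loop_spheres A 1 1)
    + card (loop_spheres A 2 0) + 2 * card (bridge_spheres A 1)"
proof -
  let ?L = "labelled_spheres A 3"
  let ?X = "\<lambda>s. {d \<in> ?L. loop_cut (fst d) (snd d) (s (fst d))}"
  let ?B = "\<lambda>j. {d \<in> ?L. snd d (hd (hd (fst d))) \<in> set (fst d ! j)}"
  let ?s0 = "\<lambda>Fs. {#}" and ?s1 = "\<lambda>Fs. {#Fs ! 1#}" and ?s2 = "\<lambda>Fs. {#Fs ! 2#}"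
    and ?s3 = "\<lambda>Fs. {#Fs ! 1, Fs ! 2#}"
  have nm: "Suc (Suc 1) = 3" "Suc (0 + 2) = 3" "Suc (1 + 1) = 3" "Suc (2 + 0) = 3" by simp_all
  have X: "loop_spheres A 0 2 = ?X ?s0" "loop_spheres A 1 1 = ?X ?s1" "loop_spheres A 2 0 = ?X ?s3"
    and B1: "bridge_spheres A 1 = ?B 1"
    unfolding loop_spheres_def bridge_spheres_def nm case_prod_beta prod.collapse
    by (intro Collect_cong conj_cong refl; auto elim!: labelled_spheres_3E)+
  have "?X ?s2 = {d \<in> ?L. loop_cut (fst (swap_faces d)) (snd (swap_faces d)) (?s1 (fst (swap_faces d)))}"
    by (intro Collect_cong conj_cong refl, elim labelled_spheres_3E)
      (auto simp: swap_faces_def intro: loop_cut_tail)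
  then have X2: "card (?X ?s2) = card (?X ?s1)"
    using card_swap_faces[of A "\<lambda>d. loop_cut (fst d) (snd d) (?s1 (fst d))"] by simp
  have "?B 2 = {d \<in> ?L. snd (swap_faces d) (hd (hd (fst (swap_faces d)))) \<in> set (fst (swap_faces d) ! 1)}"
    by (intro Collect_cong conj_cong refl) (auto simp: swap_faces_def elim!: labelled_spheres_3E)
  then have B2: "card (?B 2) = card (?B 1)"
    using card_swap_faces[of A "\<lambda>d. snd d (hd (hd (fst d))) \<in> set (fst d ! 1)"] by simp
  have fin: "finite ?L" by (rule finite_labelled_spheres[OF A(1)])
  have uniq: "s (fst d) = t (fst d)"
    if d: "d \<in> ?X s" "d \<in> ?X t" and st: "s \<in> {?s0, ?s1, ?s2, ?s3}" "t \<in> {?s0, ?s1, ?s2, ?s3}" for d s t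
  proof -
    obtain F1 F2 F3 \<iota> where de: "d = ([F1, F2, F3], \<iota>)" using d labelled_spheres_3E by blast
    have "u [F1, F2, F3] \<subseteq># mset (tl [F1, F2, F3])" if "u \<in> {?s0, ?s1, ?s2, ?s3}" for u
      using that by auto
    moreover have "sphere (mset [F1, F2, F3]) \<iota>" using d de by (auto simp: labelled_spheres_def)
    ultimately show ?thesis using d st unfolding de by (intro loop_cut_unique[of "[F1, F2, F3]" \<iota>]) auto
  qed
  \<comment> \<open>Needed to tell the two singleton cases apart; disjoint faces could be equal only
    if both were empty.\<close>
  have ne: "fst d ! 1 \<noteq> fst d ! 2" if L: "d \<in> ?L" for d
  proof -
    obtain F1 F2 F3 \<iota> where de: "d = ([F1, F2, F3], \<iota>)" using labelled_spheres_3E[OF L] .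
    have "F2 \<noteq> []" using labelled_spheres_nonempty_faces[of "[F1, F2, F3]" \<iota> A] L A(2) de by auto
    moreover have "set F2 \<inter> set F3 = {}"
      using L de by (auto simp: labelled_spheres_def sphere_def simple_add_mset)
    ultimately show ?thesis using de by auto
  qed
  have disjX: "?X s \<inter> ?X t = {}"
    if "s \<in> {?s0, ?s1, ?s2, ?s3}" "t \<in> {?s0, ?s1, ?s2, ?s3}" "\<And>d. d \<in> ?L \<Longrightarrow> s (fst d) \<noteq> t (fst d)" for s t
    using uniq[of _ s t] that by blast
  have dX: "?X ?s0 \<inter> ?X ?s1 = {}" "(?X ?s0 \<union> ?X ?s1) \<inter> ?X ?s2 = {}"
    "(?X ?s0 \<union> ?X ?s1 \<union> ?X ?s2) \<inter> ?X ?s3 = {}"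
    unfolding Int_Un_distrib2 Un_empty
    by (intro conjI disjX; use ne in \<open>auto simp: add_eq_conv_ex\<close>)+
  have loops: "?X ?s0 \<union> ?X ?s1 \<union> ?X ?s2 \<union> ?X ?s3 = ?B 0"
  proof (intro equalityI subsetI)
    fix d assume "d \<in> ?X ?s0 \<union> ?X ?s1 \<union> ?X ?s2 \<union> ?X ?s3"
    then show "d \<in> ?B 0" by (auto simp: loop_cut_def)
  next
    fix d assume d: "d \<in> ?B 0"
    then have L: "d \<in> ?L" by simp
    obtain F1 F2 F3 \<iota> where de: "d = ([F1, F2, F3], \<iota>)" using labelled_spheres_3E[OF L] .
    have "F1 \<noteq> []" using labelled_spheres_nonempty_faces[of "[F1, F2, F3]" \<iota> A] L A(2) de by auto
    then obtain a xs where F1: "F1 = a # xs" by (cases F1) auto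
    have sp: "sphere (add_mset F1 {#F2, F3#}) \<iota>" using L de by (simp add: labelled_spheres_def)
    then have "\<iota> a \<noteq> a" unfolding F1 by (auto simp: sphere_def matching_def)
    then have "\<iota> a \<in> set xs" using d de F1 by simp
    then obtain ys b zs where xs: "xs = ys @ b # zs" "\<iota> a = b" by (metis split_list)
    obtain G H where GH: "{#F2, F3#} = G + H" "\<iota> ` dset (add_mset ys G) \<subseteq> dset (add_mset ys G)"
      using sphere_loop_separates[OF sp[unfolded F1 xs(1)] xs(2)] .
    then have "loop_cut [F1, F2, F3] \<iota> G" unfolding loop_cut_def F1 xs(1) using xs(2) by blast
    moreover have "G = {#} \<or> G = {#F2#} \<or> G = {#F3#} \<or> G = {#F2, F3#}"
      by (rule subset_mset_pair) (simp add: GH(1))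
    ultimately show "d \<in> ?X ?s0 \<union> ?X ?s1 \<union> ?X ?s2 \<union> ?X ?s3"
      using L de by auto
  qed
  have all: "?L = ?B 0 \<union> ?B 1 \<union> ?B 2"
  proof (intro equalityI subsetI)
    fix d assume L: "d \<in> ?L"
    obtain F1 F2 F3 \<iota> where de: "d = ([F1, F2, F3], \<iota>)" using labelled_spheres_3E[OF L] .
    have "F1 \<noteq> []" using labelled_spheres_nonempty_faces[of "[F1, F2, F3]" \<iota> A] L A(2) de by auto
    then have "hd F1 \<in> A" using L de by (auto simp: labelled_spheres_def)
    moreover have "matching A \<iota>" using labelled_spheres_matching L de by blast
    ultimately have "\<iota> (hd F1) \<in> A" using matching_simps(3) by metis
    then have "\<iota> (hd F1) \<in> set F1 \<union> set F2 \<union> set F3"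
      using L de by (auto simp: labelled_spheres_def)
    then show "d \<in> ?B 0 \<union> ?B 1 \<union> ?B 2" using L de by auto
  qed auto
  have faces: "set (fst d ! 0) \<inter> set (fst d ! 1) = {} \<and> set (fst d ! 0) \<inter> set (fst d ! 2) = {}
      \<and> set (fst d ! 1) \<inter> set (fst d ! 2) = {}" if L: "d \<in> ?L" for d
  proof -
    obtain F1 F2 F3 \<iota> where de: "d = ([F1, F2, F3], \<iota>)" using labelled_spheres_3E[OF L] .
    then have "simple (mset [F1, F2, F3])" using L by (auto simp: labelled_spheres_def sphere_def)
    then show ?thesis using de by (auto simp: simple_add_mset)
  qed
  have dB: "?B 0 \<inter> ?B 1 = {}" "(?B 0 \<union> ?B 1) \<inter> ?B 2 = {}"
    using faces by blast+
  have f: "finite {d \<in> ?L. P d}" for P using fin by simp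
  have "card ?L = card (?B 0) + card (?B 1) + card (?B 2)"
    using arg_cong[OF all, of card] card_Un_disjoint[OF finite_UnI[OF f f] f dB(2)]
      card_Un_disjoint[OF f f dB(1)] by linarith
  also have "card (?B 0) = card (?X ?s0) + card (?X ?s1) + card (?X ?s2) + card (?X ?s3)"
    unfolding loops[symmetric]
    using card_Un_disjoint[OF finite_UnI[OF finite_UnI[OF f f] f] f dX(3)]
      card_Un_disjoint[OF finite_UnI[OF f f] f dX(2)] card_Un_disjoint[OF f f dX(1)] by linarith
  finally show ?thesis unfolding X B1 using X2 B2 by simp
qed

theorem theorem5:
  fixes N :: nat
  assumes "N \<ge> 2"
  shows "eps 0 N 3 =
    2 * (\<Sum>i=0..N - 2. eps1 0 i * eps 0 (N - i - 1) 3 + eps 0 i 2 * eps 0 (N - i - 1) 2)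
    + (\<Sum>i=1..2 * N - 3. (i + 1) * (i + 2) * eps_tilde0 (2 * int N - 2) (int i) 2)"
proof -
  define m where "m = N - 1"
  have m: "m \<ge> 1" and N: "N = Suc m" using assms by (auto simp: m_def)
  let ?A = "{1..2 * N}"
  have A: "finite ?A" "card ?A = 2 * Suc m" "?A \<noteq> {}" by (auto simp: N)
  let ?S = "\<lambda>k l. \<Sum>i\<le>m. eps 0 i k * eps 0 (m - i) l"
  \<comment> \<open>The reflection of \<open>i\<close> to \<open>m - i\<close> exchanges the roles
    of the two pieces.\<close>
  have S31: "?S 3 1 = ?S 1 3"
    by (subst sum.nat_diff_reindex[symmetric, of _ "Suc m", simplified lessThan_Suc_atMost])
      (auto intro!: sum.cong)
  \<comment> \<open>The last term, \<open>i = m\<close>, contains \<open>eps 0 0 l\<close>, which is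
    0 for \<open>l \<ge> 2\<close>; hence the upper limit \<open>N - 2\<close>.\<close>
  have drop: "?S k l = (\<Sum>i=0..N - 2. eps 0 i k * eps 0 (N - i - 1) l)" if "l \<ge> 2" for k l
  proof -
    obtain m' where m': "m = Suc m'" using m by (cases m) auto
    have "eps 0 0 l = 0" using that by (simp add: eps_def)
    then have "?S k l = (\<Sum>i\<le>m'. eps 0 i k * eps 0 (m - i) l)" by (simp add: m')
    then show ?thesis by (simp add: N m' atMost_atLeast0)
  qed
  have "fact (2 * Suc m) * eps 0 N 3 = card (labelled_spheres ?A 3)"
    using card_labelled_spheres[OF A(1), of 3] A(2) by (simp add: labelled_number_def N)
  also have "\<dots> = fact (2 * Suc m) * ?S 1 3 + 2 * (fact (2 * Suc m) * ?S 2 2)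
      + fact (2 * Suc m) * ?S 3 1 + 2 * card (bridge_spheres ?A 1)"
    unfolding card_labelled_spheres_3[OF A(1,3)] card_loop_spheres[OF A(1,2)]
    by (simp add: numeral_2_eq_2 numeral_3_eq_3)
  also have "2 * card (bridge_spheres ?A 1) = fact (2 * Suc m)
      * (\<Sum>i=1..2 * m - 1. (i + 1) * (i + 2) * eps_tilde0 (2 * int m) (int i) 2)"
    by (rule card_bridge_spheres_1[OF A(2) m])
  finally have "fact (2 * Suc m) * eps 0 N 3 = fact (2 * Suc m) * (2 * (?S 1 3 + ?S 2 2)
      + (\<Sum>i=1..2 * m - 1. (i + 1) * (i + 2) * eps_tilde0 (2 * int m) (int i) 2))"
    unfolding S31 by (simp only: distrib_left mult.left_commute mult_2 ac_simps)
  then have "eps 0 N 3 = 2 * (?S 1 3 + ?S 2 2)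
      + (\<Sum>i=1..2 * m - 1. (i + 1) * (i + 2) * eps_tilde0 (2 * int m) (int i) 2)"
    by (simp only: mult_cancel1 fact_nonzero simp_thms)
  moreover have "2 * int m = 2 * int N - 2" "2 * m - 1 = 2 * N - 3" by (auto simp: N)
  moreover have "?S 1 3 + ?S 2 2
      = (\<Sum>i=0..N - 2. eps1 0 i * eps 0 (N - i - 1) 3 + eps 0 i 2 * eps 0 (N - i - 1) 2)"
    by (simp add: drop sum.distrib)
  ultimately show ?thesis by simp
qed

end
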